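(* Let $d\ge 1$ be an integer and $\lambda<0<\omega$. For any $\nu\in\mathbb{R}$, $\delta(\nu)=0$ and $\mathcal{G}_\nu=\emptyset$, where $\delta(\nu)$ and $\mathcal{G}_\nu$ are the infimum and the set of ground states defined in the context.
   Context: The space $\Sigma$ is $\Sigma=\{f\in H^1(\mathbb{R}^d)\ :\ x\mapsto |x|f(x)\in L^2(\mathbb{R}^d)\}$ (complex-valued functions), and $|u|^2\ln|u|^2$ is understood as $0$ where $u=0$. For $u\in\Sigma$, the energy is $$E(u)=\frac12\|\nabla u\|_{L^2}^2-\frac{\omega^2}{2}\|xu\|_{L^2}^2+\lambda\int_{\mathbb{R}^d}|u|^2\left(\ln|u|^2-1\right)dx.$$ For $\nu\in\mathbb{R}$, the action and the Nehari functional are $$S_\nu(u)=E(u)+\nu\|u\|_{L^2}^2,$$ $$I_\nu(u)=\|\nabla u\|_{L^2}^2-\omega^2\|xu\|_{L^2}^2+2\lambda\int_{\mathbb{R}^d}|u|^2\ln|u|^2dx+2\nu\|u\|_{L^2}^2=2S_\nu(u)+2\lambda\|u\|_{L^2}^2.$$ Define $$\delta(\nu)=\inf\{S_\nu(u)\ :\ u\in\Sigma\setminus\{0\},\ I_\nu(u)=0\}=-\lambda\inf\{\|u\|_{L^2}^2\ :\ u\in\Sigma\setminus\{0\},\ I_\nu(u)=0\},$$ and the set of ground states $$\mathcal{G}_\nu=\{\phi\in\Sigma\setminus\{0\}\ :\ I_\nu(\phi)=0,\ S_\nu(\phi)=\delta(\nu)\}.$$ *)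

theory Defs
  imports "HOL-Analysis.Analysis"
begin

text \<open>
  Elements of L2 are represented by functions, not by classes modulo equality almost everywhere;
  ``nonzero'' therefore means ``not almost everywhere zero''.
\<close>

definition L2 :: "(real^'n \<Rightarrow> 'b::euclidean_space) set" where
  "L2 = {f. f \<in> borel_measurable lebesgue \<and> integrable lebesgue (\<lambda>x. (norm (f x))\<^sup>2)}"

definition L2_norm :: "(real^'n \<Rightarrow> 'b::euclidean_space) \<Rightarrow> real" where
  "L2_norm f = sqrt (\<integral>x. (norm (f x))\<^sup>2 \<partial>lebesgue)"

definition ae_nonzero :: "(real^'n \<Rightarrow> 'b::euclidean_space) \<Rightarrow> bool" where
  "ae_nonzero f \<longleftrightarrow> \<not> (AE x in lebesgue. f x = 0)"

definition partial_deriv :: "'n \<Rightarrow> (real^'n \<Rightarrow> real) \<Rightarrow> real^'n \<Rightarrow> real" where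
  "partial_deriv i f x = frechet_derivative f (at x) (axis i 1)"

primrec C_k :: "nat \<Rightarrow> (real^'n \<Rightarrow> real) \<Rightarrow> bool" where
  "C_k 0 f \<longleftrightarrow> continuous_on UNIV f"
| "C_k (Suc k) f \<longleftrightarrow> (\<forall>x. f differentiable (at x)) \<and> (\<forall>i. C_k k (partial_deriv i f))"

definition test_function :: "(real^'n \<Rightarrow> real) \<Rightarrow> bool" where
  "test_function f \<longleftrightarrow> (\<forall>k. C_k k f) \<and> compact (closure {x. f x \<noteq> 0})"

definition has_weak_gradient :: "(real^'n \<Rightarrow> complex) \<Rightarrow> (real^'n \<Rightarrow> complex^'n) \<Rightarrow> bool" where
  "has_weak_gradient u g \<longleftrightarrow>
     (\<forall>f i. test_function f \<longrightarrow>
        (\<integral>x. partial_deriv i f x *\<^sub>R u x \<partial>lebesgue) = - (\<integral>x. f x *\<^sub>R (g x $ i) \<partial>lebesgue))"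

definition H1 :: "(real^'n \<Rightarrow> complex) set" where
  "H1 = {u \<in> L2. \<exists>g \<in> L2. has_weak_gradient u g}"

text \<open>
  A weak gradient is unique only almost everywhere, so a representative is chosen;
  its L2 norm does not depend on the choice.
\<close>

definition weak_gradient :: "(real^'n \<Rightarrow> complex) \<Rightarrow> real^'n \<Rightarrow> complex^'n" where
  "weak_gradient u = (SOME g. g \<in> L2 \<and> has_weak_gradient u g)"

definition Sigma_space :: "(real^'n \<Rightarrow> complex) set" where
  "Sigma_space = {u \<in> H1. (\<lambda>x. norm x *\<^sub>R u x) \<in> L2}"

text \<open>
  The products below vanish where \<open>u x = 0\<close>, whatever the value of \<open>ln 0\<close>, in agreement with the
  convention for \<open>|u|^2 ln |u|^2\<close>. Both logarithmic integrands are Lebesgue integrable for every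
  \<open>u\<close> in \<^const>\<open>Sigma_space\<close>, so no default value of the integral is involved there.
\<close>

definition energy :: "real \<Rightarrow> real \<Rightarrow> (real^'n \<Rightarrow> complex) \<Rightarrow> real" where
  "energy lam om u =
     1/2 * (L2_norm (weak_gradient u))\<^sup>2
     - om\<^sup>2 / 2 * (L2_norm (\<lambda>x. norm x *\<^sub>R u x))\<^sup>2
     + lam * (\<integral>x. (cmod (u x))\<^sup>2 * (ln ((cmod (u x))\<^sup>2) - 1) \<partial>lebesgue)"

definition action :: "real \<Rightarrow> real \<Rightarrow> real \<Rightarrow> (real^'n \<Rightarrow> complex) \<Rightarrow> real" where
  "action lam om nu u = energy lam om u + nu * (L2_norm u)\<^sup>2"

definition nehari :: "real \<Rightarrow> real \<Rightarrow> real \<Rightarrow> (real^'n \<Rightarrow> complex) \<Rightarrow> real" where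
  "nehari lam om nu u =
     (L2_norm (weak_gradient u))\<^sup>2
     - om\<^sup>2 * (L2_norm (\<lambda>x. norm x *\<^sub>R u x))\<^sup>2
     + 2 * lam * (\<integral>x. (cmod (u x))\<^sup>2 * ln ((cmod (u x))\<^sup>2) \<partial>lebesgue)
     + 2 * nu * (L2_norm u)\<^sup>2"

text \<open>
  The infimum is taken in the extended reals, so that it is meaningful without knowing beforehand
  that the set is nonempty and bounded below. The type argument fixes the dimension \<open>d = CARD('n)\<close>.
\<close>

definition ground_level :: "'n::finite itself \<Rightarrow> real \<Rightarrow> real \<Rightarrow> real \<Rightarrow> ereal" where
  "ground_level _ lam om nu =
     (INF u \<in> {u :: real^'n \<Rightarrow> complex. u \<in> Sigma_space \<and> ae_nonzero u \<and> nehari lam om nu u = 0}.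
        ereal (action lam om nu u))"

definition ground_states :: "real \<Rightarrow> real \<Rightarrow> real \<Rightarrow> (real^'n \<Rightarrow> complex) set" where
  "ground_states lam om nu =
     {u. u \<in> Sigma_space \<and> ae_nonzero u \<and> nehari lam om nu u = 0
         \<and> ereal (action lam om nu u) = ground_level TYPE('n) lam om nu}"

end

theory Submission
  imports Defs "HOL-Probability.Distributions"
begin

text \<open>
  On the Nehari manifold the action equals \<open>- \<lambda> \<parallel>u\<parallel>\<^sup>2\<close>, which is positive; so everything
  follows once the manifold is shown to contain functions of arbitrarily small mass. Take a bump
  \<open>v\<^sub>R\<close> translated to distance \<open>R\<close> and solve \<open>I(c v\<^sub>R) = 0\<close> for \<open>c\<close>: this makes \<open>ln c\<^sup>2\<close> an affine
  function of \<open>- \<omega>\<^sup>2 \<parallel>x v\<^sub>R\<parallel>\<^sup>2\<close> with positive slope, so \<open>c\<close> tends to \<open>0\<close> as \<open>R\<close> grows.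

  The formula for the action needs \<open>|u|\<^sup>2 ln |u|\<^sup>2\<close> to be integrable, since a divergent integral
  would count as \<open>0\<close>. The part with \<open>|u| < 1\<close> is controlled by \<open>|x|\<^sup>2 |u|\<^sup>2\<close> and a Gaussian. For
  large \<open>|u|\<close>, instead of a Sobolev embedding, comparison of \<open>u\<close> with its translates by at most
  \<open>\<epsilon>\<close> bounds the mass of \<open>u\<close> above a level of order \<open>\<epsilon>\<^sup>-\<^sup>d\<close> by a multiple of \<open>\<epsilon>\<^sup>2\<close>; summation
  over \<open>\<epsilon> = 2\<^sup>-\<^sup>k\<close> yields the logarithm.
\<close>

section \<open>Tensor products of smooth functions of one variable\<close>

text \<open>Weak derivatives are tested only against products of one-variable functions.
  Differentiation in one coordinate changes one factor, so averaging a test function over a segment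
  of an axis stays inside the class, and its derivative is a difference; this converts the weak
  derivative into a bound on translates. Such products also approximate indicators of boxes, which
  makes weak gradients unique almost everywhere. Uniqueness matters because
  \<open>weak_gradient\<close> is chosen by \<open>SOME\<close>: \<open>nehari\<close> of an
  explicit function can be evaluated only after the chosen gradient is identified with the classical
  one.

  The argument by translates is uniform in the dimension, where Sobolev exponents would need a case
  distinction. The levels in the tail estimate grow geometrically, so ln |u|^2 is at most linear in
  the number of levels passed, while the masses above them decay geometrically.

  Moving the bump changes only the weighted term of \<open>nehari\<close>; its mass, its gradient
  term and its logarithmic term are translation invariant. This is why the single parameter
  \<open>R\<close> can drive the solution ln c^2 to minus infinity.\<close>

primrec times_differentiable :: "nat \<Rightarrow> (real \<Rightarrow> real) \<Rightarrow> bool" where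
  "times_differentiable 0 f \<longleftrightarrow> continuous_on UNIV f"
| "times_differentiable (Suc n) f \<longleftrightarrow>
     (\<exists>f'. (\<forall>x. (f has_real_derivative f' x) (at x)) \<and> times_differentiable n f')"

lemma times_differentiable_mono: "times_differentiable (Suc n) f \<Longrightarrow> times_differentiable n f"
proof (induction n arbitrary: f)
  case 0
  then show ?case
    by (auto intro!: continuous_at_imp_continuous_on intro: DERIV_isCont)
next
  case (Suc n)
  then obtain f' where "\<forall>x. (f has_real_derivative f' x) (at x)" "times_differentiable (Suc n) f'"
    by (subst (asm) times_differentiable.simps(2)) blast
  with Suc.IH show ?case by auto
qed

lemma times_differentiable_add:
  "times_differentiable n f \<Longrightarrow> times_differentiable n g \<Longrightarrow> times_differentiable n (\<lambda>x. f x + g x)"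
proof (induction n arbitrary: f g)
  case (Suc n)
  then obtain f' g' where "\<forall>x. (f has_real_derivative f' x) (at x)" "times_differentiable n f'"
    "\<forall>x. (g has_real_derivative g' x) (at x)" "times_differentiable n g'" by auto
  with Suc.IH show ?case
    by (auto intro!: exI[of _ "\<lambda>x. f' x + g' x"] DERIV_add)
qed (auto intro: continuous_intros)

text \<open>The factor \<open>c\<close> belongs to the statement because each differentiation
  multiplies it by \<open>a\<close>; with \<open>c\<close> arbitrary the induction closes.\<close>

lemma times_differentiable_affine:
  "times_differentiable n f \<Longrightarrow> times_differentiable n (\<lambda>x. c * f (a * x + b))"
proof (induction n arbitrary: f c)
  case 0
  then show ?case
    by (auto intro!: continuous_intros continuous_on_compose2[of UNIV f])
next
  case (Suc n)
  then obtain f' where f': "\<forall>x. (f has_real_derivative f' x) (at x)" "times_differentiable n f'" by auto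
  have "((\<lambda>x. c * f (a * x + b)) has_real_derivative (c * a) * f' (a * x + b)) (at x)" for x
    by (rule derivative_eq_intros DERIV_chain2[OF f'(1)[rule_format]] refl)+ simp
  with Suc.IH[OF f'(2), of "c * a"] show ?case
    by (auto intro!: exI[of _ "\<lambda>x. c * a * f' (a * x + b)"])
qed

lemma times_differentiable_mult:
  "times_differentiable n f \<Longrightarrow> times_differentiable n g \<Longrightarrow> times_differentiable n (\<lambda>x. f x * g x)"
proof (induction n arbitrary: f g)
  case (Suc n)
  then obtain f' g' where fg: "\<forall>x. (f has_real_derivative f' x) (at x)" "times_differentiable n f'"
    "\<forall>x. (g has_real_derivative g' x) (at x)" "times_differentiable n g'" by auto
  have "times_differentiable n (\<lambda>x. f x * g' x + f' x * g x)"
    using Suc fg times_differentiable_mono by (intro times_differentiable_add Suc.IH) auto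
  with fg show ?case
    by (auto intro!: exI[of _ "\<lambda>x. f x * g' x + f' x * g x"] derivative_eq_intros)
qed (auto intro: continuous_intros)

definition smooth :: "(real \<Rightarrow> real) \<Rightarrow> bool" where
  "smooth f \<longleftrightarrow> (\<forall>n. times_differentiable n f)"

lemma smooth_continuous: "smooth f \<Longrightarrow> continuous_on UNIV f"
  unfolding smooth_def by (metis times_differentiable.simps(1))

lemma smooth_DERIV: "smooth f \<Longrightarrow> (f has_real_derivative deriv f x) (at x)"
  unfolding smooth_def by (metis times_differentiable.simps(2) DERIV_imp_deriv)

lemma smooth_deriv:
  assumes "smooth f"
  shows "smooth (deriv f)"
  unfolding smooth_def
proof
  fix n
  obtain f' where f': "\<forall>x. (f has_real_derivative f' x) (at x)" "times_differentiable n f'"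
    using assms unfolding smooth_def by (metis times_differentiable.simps(2))
  then have "deriv f = f'" by (auto intro: DERIV_imp_deriv)
  with f' show "times_differentiable n (deriv f)" by simp
qed

lemma smooth_antiderivative:
  assumes "smooth f" "\<And>x. (F has_real_derivative f x) (at x)"
  shows "smooth F"
proof -
  have "times_differentiable (Suc n) F" for n
    using assms unfolding smooth_def by auto
  then show ?thesis
    unfolding smooth_def using times_differentiable_mono by blast
qed

lemma smooth_mult: "smooth f \<Longrightarrow> smooth g \<Longrightarrow> smooth (\<lambda>x. f x * g x)"
  unfolding smooth_def using times_differentiable_mult by blast

lemma smooth_affine: "smooth f \<Longrightarrow> smooth (\<lambda>x. c * f (a * x + b))"
  unfolding smooth_def using times_differentiable_affine by blast

lemma smooth_diff: "smooth f \<Longrightarrow> smooth g \<Longrightarrow> smooth (\<lambda>x. f x - g x)"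
  unfolding smooth_def
  using times_differentiable_add times_differentiable_affine[of _ g "-1" 1 0] by fastforce

section \<open>The function exp(-1/t) and smooth cutoffs on the line\<close>

definition flat :: "real poly \<Rightarrow> real \<Rightarrow> real" where
  "flat p t = (if t > 0 then poly p (1 / t) * exp (- 1 / t) else 0)"

lemma poly_exp_decay: "((\<lambda>s. poly p s * exp (- s)) \<longlongrightarrow> 0) at_top" for p :: "real poly"
proof -
  have "((\<lambda>s. (\<Sum>i\<le>degree p. coeff p i * (s ^ i / exp s))) \<longlongrightarrow> (\<Sum>i\<le>degree p. coeff p i * 0)) at_top"
    by (intro tendsto_sum tendsto_mult tendsto_const tendsto_power_div_exp_0)
  then show ?thesis
    by (simp add: poly_altdef exp_minus sum_distrib_right divide_inverse mult.assoc)
qed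

text \<open>Polynomials in 1/t are carried along because differentiation stays within the family:
  with s = 1/t, the derivative of p(s) exp(-s) in t is s^2 (p(s) - p'(s)) exp(-s). At 0 the point is
  that exp(-s) beats every power of s.\<close>

lemma DERIV_flat: "(flat p has_real_derivative flat ([:0, 0, 1:] * (p - pderiv p)) t) (at t)"
proof -
  consider "t > 0" | "t < 0" | "t = 0" by linarith
  then show ?thesis
  proof cases
    case 1
    have "((\<lambda>t. poly p (1 / t) * exp (- 1 / t)) has_real_derivative
        flat ([:0, 0, 1:] * (p - pderiv p)) t) (at t)"
      using 1
      by (auto intro!: derivative_eq_intros simp: flat_def field_simps power2_eq_square)
    moreover have "\<forall>\<^sub>F y in nhds t. flat p y = poly p (1 / y) * exp (- 1 / y)"
      using eventually_nhds_in_open[of "{0<..}" t] 1 by (auto simp: flat_def elim!: eventually_mono)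
    ultimately show ?thesis
      by (simp add: DERIV_cong_ev)
  next
    case 2
    moreover have "\<forall>\<^sub>F y in nhds t. flat p y = 0"
      using eventually_nhds_in_open[of "{..<0}" t] 2 by (auto simp: flat_def elim!: eventually_mono)
    ultimately have "(flat p has_real_derivative 0) (at t)"
      by (simp add: DERIV_cong_ev)
    then show ?thesis using 2 by (simp add: flat_def)
  next
    case 3
    have lim: "((\<lambda>h. flat p h / h) \<longlongrightarrow> 0) (at 0)"
      unfolding filterlim_at_split
    proof
      show "((\<lambda>h. flat p h / h) \<longlongrightarrow> 0) (at_left 0)"
        by (rule tendsto_eventually) (auto simp: flat_def eventually_at_filter)
      \<comment> \<open>Dividing by \<open>h\<close> multiplies the polynomial by one more power of
        1/h, so the quotient has the form covered by \<open>poly_exp_decay\<close>.\<close>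
      have "((\<lambda>h. poly (p * [:0, 1:]) (inverse h) * exp (- inverse h)) \<longlongrightarrow> 0) (at_right (0::real))"
        using filterlim_compose[OF poly_exp_decay filterlim_inverse_at_top_right] .
      then show "((\<lambda>h. flat p h / h) \<longlongrightarrow> 0) (at_right 0)"
        by (rule Lim_transform_eventually)
           (auto simp: flat_def eventually_at_filter divide_inverse)
    qed
    then show ?thesis using 3 by (simp add: DERIV_def flat_def)
  qed
qed

lemma smooth_flat: "smooth (flat p)"
proof -
  have "times_differentiable n (flat p)" for n
  proof (induction n arbitrary: p)
    case 0
    then show ?case using DERIV_flat by (auto intro!: continuous_at_imp_continuous_on intro: DERIV_isCont)
  next
    case (Suc n)
    then show ?case using DERIV_flat by auto
  qed
  then show ?thesis by (simp add: smooth_def)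
qed

text \<open>The parameter \<open>n\<close> sharpens the cutoff without enlarging its support: for n
  > 0 the function is positive exactly on the open interval from \<open>a\<close> to
  \<open>b\<close>, and it tends to the indicator of that interval as \<open>n\<close>
  grows.\<close>

definition bump :: "real \<Rightarrow> real \<Rightarrow> nat \<Rightarrow> real \<Rightarrow> real" where
  "bump a b n t = flat 1 (real n * (t - a)) * flat 1 (real n * (b - t))"

lemma smooth_bump: "smooth (bump a b n)"
  using smooth_mult[OF smooth_affine[OF smooth_flat[of 1], of 1 "real n" "- real n * a"]
      smooth_affine[OF smooth_flat[of 1], of 1 "- real n" "real n * b"]]
  unfolding bump_def by (simp add: algebra_simps)

lemma flat_1_bounds: "0 \<le> flat 1 t" "flat 1 t \<le> 1"
  by (auto simp: flat_def)

lemma bump_bounds: "0 \<le> bump a b n t" "bump a b n t \<le> 1"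
  by (auto simp: bump_def intro!: mult_nonneg_nonneg mult_le_one flat_1_bounds)

lemma bump_eq_0: "t \<notin> {a<..<b} \<Longrightarrow> bump a b n t = 0"
  by (auto simp: bump_def flat_def zero_less_mult_iff)

lemma bump_pos: "t \<in> {a<..<b} \<Longrightarrow> 0 < n \<Longrightarrow> 0 < bump a b n t"
  by (auto simp: bump_def flat_def zero_less_mult_iff)

lemma flat_1_LIMSEQ: "(\<lambda>n. flat 1 (real n * t)) \<longlonglongrightarrow> (if 0 < t then 1 else 0)"
proof (cases "0 < t")
  case True
  have "(\<lambda>n. exp (- (1 / t) * (1 / real n))) \<longlonglongrightarrow> exp (- (1 / t) * 0)"
    by (intro tendsto_intros lim_1_over_n)
  moreover have "\<forall>\<^sub>F n in sequentially. exp (- (1 / t) * (1 / real n)) = flat 1 (real n * t)"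
    using True by (auto simp: flat_def intro: eventually_mono[OF eventually_gt_at_top[of 0]])
  ultimately show ?thesis using True by (auto dest: Lim_transform_eventually)
next
  case False
  then have "flat 1 (real n * t) = 0" for n
    by (auto simp: flat_def zero_less_mult_iff)
  with False show ?thesis by simp
qed

lemma bump_LIMSEQ: "(\<lambda>n. bump a b n t) \<longlonglongrightarrow> indicator {a<..<b} t"
  using tendsto_mult[OF flat_1_LIMSEQ[of "t - a"] flat_1_LIMSEQ[of "b - t"]]
  by (auto simp: bump_def indicator_def split: if_splits)

section \<open>Test functions of product form\<close>

definition tensor :: "('n \<Rightarrow> real \<Rightarrow> real) \<Rightarrow> real^'n::finite \<Rightarrow> real" where
  "tensor \<phi> x = (\<Prod>i\<in>UNIV. \<phi> i (x $ i))"

lemma tensor_upd: "tensor (\<phi>(i := \<psi>)) x = \<psi> (x $ i) * (\<Prod>j\<in>UNIV - {i}. \<phi> j (x $ j))"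
  unfolding tensor_def by (subst prod.remove[of UNIV i]) (auto intro!: prod.cong)

lemma tensor_has_derivative:
  assumes "\<And>i. smooth (\<phi> i)"
  shows "(tensor \<phi> has_derivative
           (\<lambda>y. \<Sum>i\<in>UNIV. deriv (\<phi> i) (x $ i) * (y $ i) * (\<Prod>j\<in>UNIV - {i}. \<phi> j (x $ j)))) (at x)"
  unfolding tensor_def
proof (rule has_derivative_prod)
  fix i
  have "((\<lambda>x. x $ i) has_derivative (\<lambda>y. y $ i)) (at x)"
    by (rule bounded_linear.has_derivative[OF bounded_linear_vec_nth has_derivative_ident])
  moreover have "(\<phi> i has_derivative (*) (deriv (\<phi> i) (x $ i))) (at (x $ i))"
    using smooth_DERIV[OF assms] by (simp add: has_field_derivative_def)
  ultimately show "((\<lambda>x. \<phi> i (x $ i)) has_derivative (\<lambda>y. deriv (\<phi> i) (x $ i) * y $ i)) (at x)"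
    using has_derivative_compose by blast
qed

lemma partial_deriv_tensor:
  assumes "\<And>i. smooth (\<phi> i)"
  shows "partial_deriv i (tensor \<phi>) = tensor (\<phi>(i := deriv (\<phi> i)))"
proof
  fix x
  have "partial_deriv i (tensor \<phi>) x =
      (\<Sum>k\<in>UNIV. deriv (\<phi> k) (x $ k) * (axis i 1 $ k) * (\<Prod>j\<in>UNIV - {k}. \<phi> j (x $ j)))"
    unfolding partial_deriv_def
    by (subst frechet_derivative_at[OF tensor_has_derivative[OF assms], symmetric]) simp
  also have "\<dots> = (\<Sum>k\<in>UNIV. if k = i then deriv (\<phi> i) (x $ i) * (\<Prod>j\<in>UNIV - {i}. \<phi> j (x $ j)) else 0)"
    by (intro sum.cong) (auto simp: axis_def)
  also have "\<dots> = deriv (\<phi> i) (x $ i) * (\<Prod>j\<in>UNIV - {i}. \<phi> j (x $ j))"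
    by simp
  also have "\<dots> = tensor (\<phi>(i := deriv (\<phi> i))) x"
    by (simp only: tensor_upd)
  finally show "partial_deriv i (tensor \<phi>) x = tensor (\<phi>(i := deriv (\<phi> i))) x" .
qed

lemma continuous_on_tensor:
  assumes "\<And>i. smooth (\<phi> i)"
  shows "continuous_on S (tensor \<phi>)"
  by (intro continuous_at_imp_continuous_on ballI has_derivative_continuous[OF tensor_has_derivative[OF assms]])

lemma C_k_tensor:
  assumes "\<And>i. smooth (\<phi> i)"
  shows "C_k k (tensor \<phi>)"
  using assms
proof (induction k arbitrary: \<phi>)
  case 0
  then show ?case by (simp add: continuous_on_tensor)
next
  case (Suc k)
  have "tensor \<phi> differentiable at x" for x
    using tensor_has_derivative[of \<phi>, OF Suc.prems] unfolding differentiable_def by blast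
  moreover have "C_k k (partial_deriv i (tensor \<phi>))" for i
    using Suc by (subst partial_deriv_tensor) (auto intro!: Suc.IH smooth_deriv)
  ultimately show ?case by simp
qed

text \<open>Every factor is required to have bounded support: a single compactly supported factor
  would confine the product only to a slab. The endpoints depend on the coordinate, so that
  replacing one factor preserves the property.\<close>

definition test_factors :: "('n::finite \<Rightarrow> real \<Rightarrow> real) \<Rightarrow> bool" where
  "test_factors \<phi> \<longleftrightarrow> (\<forall>i. smooth (\<phi> i)) \<and> (\<exists>a b. \<forall>i t. t \<notin> {a i..b i} \<longrightarrow> \<phi> i t = 0)"

lemma test_factors_smooth: "test_factors \<phi> \<Longrightarrow> smooth (\<phi> i)"
  by (simp add: test_factors_def)

lemma tensor_support:
  assumes "test_factors \<phi>"
  obtains a b where "\<And>x. x \<notin> cbox a b \<Longrightarrow> tensor \<phi> x = 0"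
proof -
  obtain a b where ab: "\<forall>i t. t \<notin> {a i..b i} \<longrightarrow> \<phi> i t = 0"
    using assms by (auto simp: test_factors_def)
  show ?thesis
    by (rule that[of "\<chi> i. a i" "\<chi> i. b i"]) (use ab in \<open>force simp: tensor_def mem_box_cart\<close>)
qed

lemma test_function_tensor:
  assumes "test_factors \<phi>"
  shows "test_function (tensor \<phi>)"
  unfolding test_function_def
proof
  show "\<forall>k. C_k k (tensor \<phi>)" by (simp add: C_k_tensor test_factors_smooth assms)
  obtain a b where "\<And>x. x \<notin> cbox a b \<Longrightarrow> tensor \<phi> x = 0"
    using tensor_support assms by blast
  then have "bounded {x. tensor \<phi> x \<noteq> 0}"
    using bounded_subset[OF bounded_cbox[of a b], of "{x. tensor \<phi> x \<noteq> 0}"] by blast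
  then show "compact (closure {x. tensor \<phi> x \<noteq> 0})" by simp
qed

lemma test_factors_upd:
  assumes "test_factors \<phi>" "smooth \<psi>" "\<And>t. t \<notin> {c..d} \<Longrightarrow> \<psi> t = 0"
  shows "test_factors (\<phi>(i := \<psi>))"
proof -
  obtain a b where ab: "\<forall>i t. t \<notin> {a i..b i} \<longrightarrow> \<phi> i t = 0"
    using assms by (auto simp: test_factors_def)
  show ?thesis
    unfolding test_factors_def
    by (intro conjI exI[of _ "a(i := c)"] exI[of _ "b(i := d)"]) (use ab assms in \<open>auto simp: test_factors_def\<close>)
qed

lemma test_factors_bump: "test_factors (\<lambda>i. bump (a i) (b i) n)"
  unfolding test_factors_def
  by (intro conjI allI smooth_bump exI[of _ a] exI[of _ b]) (auto intro: bump_eq_0)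

lemma continuous_compact_support_bounded:
  fixes f :: "real^'n \<Rightarrow> 'b::euclidean_space"
  assumes "continuous_on UNIV f" "\<And>x. x \<notin> cbox a b \<Longrightarrow> f x = 0"
  obtains C where "C > 0" "\<And>x. norm (f x) \<le> C"
proof -
  have "bounded (f ` cbox a b)"
    using assms(1) by (intro compact_imp_bounded compact_continuous_image continuous_on_subset[OF assms(1)]) auto
  then obtain C where C: "C > 0" "\<And>x. x \<in> cbox a b \<Longrightarrow> norm (f x) \<le> C"
    unfolding bounded_pos by auto
  then show ?thesis
    using assms(2) by (intro that[of C]) (metis less_imp_le norm_zero)+
qed

lemma continuous_compact_support_integrable:
  fixes f :: "real^'n \<Rightarrow> 'b::euclidean_space"
  assumes "continuous_on UNIV f" "\<And>x. x \<notin> cbox a b \<Longrightarrow> f x = 0"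
  shows "integrable lborel f" "integrable lebesgue f"
proof -
  have "integrable lborel (\<lambda>x. indicator (cbox a b) x *\<^sub>R f x)"
    by (intro borel_integrable_compact continuous_on_subset[OF assms(1)]) auto
  also have "(\<lambda>x. indicator (cbox a b) x *\<^sub>R f x) = f"
    using assms(2) by (auto simp: indicator_def)
  finally show "integrable lborel f" .
  then show "integrable lebesgue f"
    using assms(1) by (auto simp: integrable_completion borel_measurable_continuous_onI)
qed

lemma tensor_bounded:
  assumes "test_factors \<phi>"
  obtains C where "C > 0" "\<And>x. \<bar>tensor \<phi> x\<bar> \<le> C"
  using tensor_support[OF assms] continuous_compact_support_bounded[OF continuous_on_tensor, of \<phi>]
    test_factors_smooth[OF assms] by (metis real_norm_def)

lemma tensor_integrable:
  assumes "test_factors \<phi>"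
  shows "integrable lborel (tensor \<phi>)"
  using tensor_support[OF assms] continuous_compact_support_integrable(1)[OF continuous_on_tensor, of \<phi>]
    test_factors_smooth[OF assms] by metis

lemma borel_measurable_tensor[measurable]:
  assumes "test_factors \<phi>"
  shows "tensor \<phi> \<in> borel_measurable borel"
  by (intro borel_measurable_continuous_onI continuous_on_tensor test_factors_smooth assms)

section \<open>Weak gradients are unique\<close>

lemma integrable_dominated:
  fixes f :: "'a \<Rightarrow> 'b::{banach, second_countable_topology}" and g :: "'a \<Rightarrow> 'c::{banach, second_countable_topology}"
  assumes "integrable M g" "f \<in> borel_measurable M" "\<And>x. norm (f x) \<le> norm (g x)"
  shows "integrable M f"
  by (rule Bochner_Integration.integrable_bound[OF assms(1,2)]) (simp add: assms(3))

text \<open>On a box, where constants are integrable, |h| <= 1 + |h|^2 is enough; no Cauchy-Schwarz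
  inequality is involved.\<close>

lemma L2_locally_integrable:
  fixes h :: "real^'n \<Rightarrow> 'b::euclidean_space"
  assumes "h \<in> L2"
  shows "set_integrable lebesgue (cbox a b) h"
proof -
  have [measurable]: "h \<in> borel_measurable lebesgue" and i: "integrable lebesgue (\<lambda>x. (norm (h x))\<^sup>2)"
    using assms by (auto simp: L2_def)
  have "integrable lebesgue (\<lambda>x. indicator (cbox a b) x + (norm (h x))\<^sup>2 :: real)"
    by (intro Bochner_Integration.integrable_add i) (auto intro: integrable_real_indicator simp: emeasure_lborel_cbox_eq)
  moreover have "norm (indicator (cbox a b) x *\<^sub>R h x) \<le> norm (indicator (cbox a b) x + (norm (h x))\<^sup>2 :: real)" for x
  proof -
    have "0 \<le> (norm (h x) - 1 / 2)\<^sup>2" by simp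
    then have "norm (h x) \<le> 1 + (norm (h x))\<^sup>2" by (simp add: power2_eq_square algebra_simps)
    then show ?thesis by (auto simp: indicator_def)
  qed
  moreover have "(\<lambda>x. indicator (cbox a b) x *\<^sub>R h x) \<in> borel_measurable lebesgue"
    by (intro borel_measurable_scaleR borel_measurable_indicator) auto
  ultimately show ?thesis
    unfolding set_integrable_def by (metis (no_types, lifting) integrable_dominated)
qed

lemma tensor_scaleR_integrable:
  fixes h :: "real^'n \<Rightarrow> 'b::euclidean_space"
  assumes "\<And>a b. set_integrable lebesgue (cbox a b) h" "test_factors \<phi>"
  shows "integrable lebesgue (\<lambda>x. tensor \<phi> x *\<^sub>R h x)"
proof -
  obtain a b where ab: "\<And>x. x \<notin> cbox a b \<Longrightarrow> tensor \<phi> x = 0"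
    using tensor_support assms(2) by blast
  obtain C where C: "C > 0" "\<And>x. \<bar>tensor \<phi> x\<bar> \<le> C"
    using tensor_bounded[OF assms(2)] by blast
  have i: "integrable lebesgue (\<lambda>x. indicator (cbox a b) x *\<^sub>R h x)"
    using assms(1)[of a b] by (simp add: set_integrable_def)
  have eq: "tensor \<phi> x *\<^sub>R h x = tensor \<phi> x *\<^sub>R (indicator (cbox a b) x *\<^sub>R h x)" for x
    using ab[of x] by (auto simp: indicator_def)
  have [measurable]: "tensor \<phi> \<in> borel_measurable lebesgue"
    using borel_measurable_tensor[OF assms(2)] by (simp add: measurable_completion)
  show ?thesis
    unfolding eq
  proof (rule Bochner_Integration.integrable_bound)
    show "integrable lebesgue (\<lambda>x. C *\<^sub>R (indicator (cbox a b) x *\<^sub>R h x))"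
      using i by (rule Bochner_Integration.integrable_scaleR_right)
    show "(\<lambda>x. tensor \<phi> x *\<^sub>R (indicator (cbox a b) x *\<^sub>R h x)) \<in> borel_measurable lebesgue"
      using borel_measurable_integrable[OF i] by measurable
    show "AE x in lebesgue. norm (tensor \<phi> x *\<^sub>R (indicator (cbox a b) x *\<^sub>R h x))
            \<le> norm (C *\<^sub>R (indicator (cbox a b) x *\<^sub>R h x))"
      using C by (auto intro!: AE_I2 mult_right_mono simp: abs_mult indicator_def)
  qed
qed

lemma bump_tensor_LIMSEQ:
  "(\<lambda>n. tensor (\<lambda>i. bump (a $ i) (b $ i) n) x) \<longlonglongrightarrow> indicator (box a b) x"
proof -
  have "(\<lambda>n. \<Prod>i\<in>UNIV. bump (a $ i) (b $ i) n (x $ i)) \<longlonglongrightarrow> (\<Prod>i\<in>UNIV. indicator {a $ i<..<b $ i} (x $ i))"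
    by (intro tendsto_prod bump_LIMSEQ)
  also have "(\<Prod>i\<in>UNIV. indicator {a $ i<..<b $ i} (x $ i)) = (indicator (box a b) x :: real)"
    by (auto simp: indicator_def mem_box_cart)
  finally show ?thesis by (simp add: tensor_def)
qed

text \<open>Product bumps converge boundedly to the indicator of an open box, so the integral of
  \<open>h\<close> over every box is zero, and \<open>h\<close> is recovered from its means over
  small cubes.\<close>

lemma AE_eq_0_if_tensor_integrals_0:
  fixes h :: "real^'n \<Rightarrow> 'b::euclidean_space"
  assumes h: "\<And>a b. set_integrable lebesgue (cbox a b) h"
    and 0: "\<And>\<phi>. test_factors \<phi> \<Longrightarrow> (\<integral>x. tensor \<phi> x *\<^sub>R h x \<partial>lebesgue) = 0"
  shows "AE x in lebesgue. h x = 0"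
proof -
  have cbox_0: "integral (cbox a b) h = 0" for a b
  proof -
    let ?s = "\<lambda>n x. tensor (\<lambda>i. bump (a $ i) (b $ i) n) x *\<^sub>R h x"
    have i: "integrable lebesgue (\<lambda>x. indicator (cbox a b) x *\<^sub>R h x)"
      using h[of a b] by (simp add: set_integrable_def)
    have box_i: "set_integrable lebesgue (box a b) h"
      by (rule set_integrable_subset[OF h[of a b]]) (auto simp: box_subset_cbox)
    have "(\<lambda>n. integral\<^sup>L lebesgue (?s n)) \<longlonglongrightarrow> (\<integral>x. indicator (box a b) x *\<^sub>R h x \<partial>lebesgue)"
    proof (rule integral_dominated_convergence)
      show "(\<lambda>x. indicator (box a b) x *\<^sub>R h x) \<in> borel_measurable lebesgue"
        using box_i by (auto simp: set_integrable_def dest: borel_measurable_integrable)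
      show "?s n \<in> borel_measurable lebesgue" for n
        by (intro borel_measurable_integrable tensor_scaleR_integrable h test_factors_bump)
      show "integrable lebesgue (\<lambda>x. norm (indicator (cbox a b) x *\<^sub>R h x))"
        using i by (rule integrable_norm)
      show "AE x in lebesgue. (\<lambda>n. ?s n x) \<longlonglongrightarrow> indicator (box a b) x *\<^sub>R h x"
        by (intro AE_I2 tendsto_scaleR bump_tensor_LIMSEQ tendsto_const)
      have le: "\<bar>tensor (\<lambda>i. bump (a $ i) (b $ i) n) x\<bar> \<le> indicator (cbox a b) x" for n x
      proof (cases "x \<in> cbox a b")
        case True
        then show ?thesis
          by (auto simp: tensor_def abs_prod bump_bounds intro!: prod_le_1)
      next
        case False
        then obtain i where "x $ i \<notin> {a $ i<..<b $ i}"
          unfolding mem_box_cart by (metis greaterThanLessThan_iff less_imp_le)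
        then have "bump (a $ i) (b $ i) n (x $ i) = 0" by (rule bump_eq_0)
        then have "tensor (\<lambda>i. bump (a $ i) (b $ i) n) x = 0"
          by (auto simp: tensor_def)
        then show ?thesis by simp
      qed
      show "AE x in lebesgue. norm (?s n x) \<le> norm (indicator (cbox a b) x *\<^sub>R h x)" for n
        using le by (auto intro!: AE_I2 mult_right_mono)
    qed
    then have "(\<integral>x. indicator (box a b) x *\<^sub>R h x \<partial>lebesgue) = 0"
      using 0[OF test_factors_bump] by (simp add: LIMSEQ_const_iff)
    then show ?thesis
      using set_lebesgue_integral_eq_integral(2)[OF box_i]
      by (simp add: set_lebesgue_integral_def integral_open_interval)
  qed
  have "h integrable_on cbox a b" for a b
    using set_lebesgue_integral_eq_integral(1)[OF h] .
  \<comment> \<open>Lebesgue differentiation: outside a negligible set \<open>h x\<close> is the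
    limit of the means over cubes with corner \<open>x\<close>, and these all vanish.\<close>
  then obtain N where N: "negligible N"
      "\<And>x e. \<lbrakk>x \<notin> N; 0 < e\<rbrakk> \<Longrightarrow> \<exists>d>0. \<forall>r. 0 < r \<and> r < d \<longrightarrow>
        norm (integral (cbox x (x + r *\<^sub>R One)) h /\<^sub>R r ^ DIM(real^'n) - h x) < e"
    using integrable_ccontinuous_explicit[of h] by blast
  have "h x = 0" if x: "x \<notin> N" for x
  proof (rule ccontr)
    assume "h x \<noteq> 0"
    then obtain d where "d > 0" and d: "\<forall>r. 0 < r \<and> r < d \<longrightarrow>
        norm (integral (cbox x (x + r *\<^sub>R One)) h /\<^sub>R r ^ DIM(real^'n) - h x) < norm (h x)"
      using N(2)[OF x, of "norm (h x)"] by auto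
    then obtain r where "0 < r" "r < d" using dense by blast
    with d show False by (simp add: cbox_0)
  qed
  then show ?thesis
    using N(1) by (intro AE_I'[of N]) (auto simp: negligible_iff_null_sets)
qed

lemma L2_nth:
  fixes g :: "real^'n \<Rightarrow> complex^'n"
  assumes "g \<in> L2"
  shows "(\<lambda>x. g x $ i) \<in> L2"
proof -
  have [measurable]: "g \<in> borel_measurable lebesgue" and i: "integrable lebesgue (\<lambda>x. (norm (g x))\<^sup>2)"
    using assms by (auto simp: L2_def)
  have "(\<lambda>y. y $ i) \<in> borel_measurable borel"
    by (intro borel_measurable_continuous_onI continuous_intros)
  then have [measurable]: "(\<lambda>x. g x $ i) \<in> borel_measurable lebesgue"
    by (rule measurable_compose[rotated]) measurable
  have "integrable lebesgue (\<lambda>x. (norm (g x $ i))\<^sup>2)"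
  proof (rule integrable_dominated[OF i])
    show "norm ((norm (g x $ i))\<^sup>2) \<le> norm ((norm (g x))\<^sup>2)" for x
      by (simp add: power_mono Finite_Cartesian_Product.norm_nth_le)
  qed measurable
  then show ?thesis by (simp add: L2_def)
qed

lemma norm_add_sq_le: "(norm (a + b))\<^sup>2 \<le> 2 * (norm a)\<^sup>2 + 2 * (norm b)\<^sup>2"
  for a b :: "'a::real_normed_vector"
proof -
  have "(norm (a + b))\<^sup>2 \<le> (norm a + norm b)\<^sup>2"
    by (intro power_mono norm_triangle_ineq) auto
  also have "\<dots> \<le> 2 * (norm a)\<^sup>2 + 2 * (norm b)\<^sup>2"
    using sum_squares_bound[of "norm a" "norm b"] by (simp add: power2_sum)
  finally show ?thesis .
qed

lemma L2_diff:
  assumes "f \<in> L2" "g \<in> L2"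
  shows "(\<lambda>x. f x - g x) \<in> L2"
proof -
  have [measurable]: "f \<in> borel_measurable lebesgue" "g \<in> borel_measurable lebesgue"
    and i: "integrable lebesgue (\<lambda>x. (norm (f x))\<^sup>2)" "integrable lebesgue (\<lambda>x. (norm (g x))\<^sup>2)"
    using assms by (auto simp: L2_def)
  have "integrable lebesgue (\<lambda>x. 2 * (norm (f x))\<^sup>2 + 2 * (norm (g x))\<^sup>2)"
    using i by simp
  moreover have "norm ((norm (f x - g x))\<^sup>2) \<le> norm (2 * (norm (f x))\<^sup>2 + 2 * (norm (g x))\<^sup>2)" for x
    using norm_add_sq_le[of "f x" "- g x"] by simp
  moreover have "(\<lambda>x. (norm (f x - g x))\<^sup>2) \<in> borel_measurable lebesgue" by measurable
  ultimately have "integrable lebesgue (\<lambda>x. (norm (f x - g x))\<^sup>2)"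
    by (metis (no_types, lifting) integrable_dominated)
  then show ?thesis by (simp add: L2_def)
qed

text \<open>Componentwise, the difference of two weak gradients is locally integrable and integrates
  to zero against every test function of product form.\<close>

lemma weak_gradient_unique:
  assumes "g \<in> L2" "g' \<in> L2" "has_weak_gradient u g" "has_weak_gradient u g'"
  shows "AE x in lebesgue. g x = g' x"
proof -
  have "AE x in lebesgue. g x $ i - g' x $ i = 0" for i
  proof (rule AE_eq_0_if_tensor_integrals_0)
    show "set_integrable lebesgue (cbox a b) (\<lambda>x. g x $ i - g' x $ i)" for a b
      using assms by (intro L2_locally_integrable L2_diff L2_nth)
    fix \<phi> :: "'a \<Rightarrow> real \<Rightarrow> real" assume \<phi>: "test_factors \<phi>"
    note test = tensor_scaleR_integrable[OF L2_locally_integrable[OF L2_nth] \<phi>]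
    have "(\<integral>x. tensor \<phi> x *\<^sub>R (g x $ i) \<partial>lebesgue) = (\<integral>x. tensor \<phi> x *\<^sub>R (g' x $ i) \<partial>lebesgue)"
      using assms(3,4) test_function_tensor[OF \<phi>] unfolding has_weak_gradient_def
      by (simp add: equation_minus_iff)
    then show "(\<integral>x. tensor \<phi> x *\<^sub>R (g x $ i - g' x $ i) \<partial>lebesgue) = 0"
      by (simp add: scaleR_diff_right Bochner_Integration.integral_diff test[OF assms(1)] test[OF assms(2)])
  qed
  then have "AE x in lebesgue. \<forall>i. g x $ i = g' x $ i"
    by (simp add: AE_all_countable)
  then show ?thesis by (simp add: vec_eq_iff)
qed

lemma weak_gradient_props:
  assumes "u \<in> H1"
  shows "weak_gradient u \<in> L2" "has_weak_gradient u (weak_gradient u)"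
proof -
  have "\<exists>g. g \<in> L2 \<and> has_weak_gradient u g"
    using assms by (auto simp: H1_def)
  from someI_ex[OF this] show "weak_gradient u \<in> L2" "has_weak_gradient u (weak_gradient u)"
    unfolding weak_gradient_def by blast+
qed

lemma L2_norm_sq: "(L2_norm f)\<^sup>2 = (\<integral>x. (norm (f x))\<^sup>2 \<partial>lebesgue)"
  by (simp add: L2_norm_def)

text \<open>Replaces the representative chosen by \<open>SOME\<close> with any known weak gradient;
  it is applied to the classical gradient of a test function.\<close>

lemma L2_norm_weak_gradient:
  assumes "u \<in> L2" "g \<in> L2" "has_weak_gradient u g"
  shows "L2_norm (weak_gradient u) = L2_norm g"
proof -
  have "u \<in> H1" using assms by (auto simp: H1_def)
  note w = weak_gradient_props[OF this]
  have "(\<integral>x. (norm (weak_gradient u x))\<^sup>2 \<partial>lebesgue) = (\<integral>x. (norm (g x))\<^sup>2 \<partial>lebesgue)"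
  proof (rule integral_cong_AE)
    show "AE x in lebesgue. (norm (weak_gradient u x))\<^sup>2 = (norm (g x))\<^sup>2"
      using weak_gradient_unique[OF w(1) assms(2) w(2) assms(3)] by eventually_elim simp
  qed (use w(1) assms(2) in \<open>simp_all add: L2_def borel_measurable_integrable\<close>)
  then show ?thesis by (simp add: L2_norm_def)
qed

section \<open>Translates of functions with a weak derivative\<close>

lemma nn_integral_lborel_translate:
  fixes c :: "'a::euclidean_space"
  assumes [measurable]: "f \<in> borel_measurable borel"
  shows "(\<integral>\<^sup>+x. f (x + c) \<partial>lborel) = (\<integral>\<^sup>+x. f x \<partial>lborel)"
  by (subst (2) lborel_distr_plus[of c, symmetric]) (simp add: nn_integral_distr add.commute)

lemma integral_lborel_translate:
  fixes c :: "'a::euclidean_space" and f :: "'a \<Rightarrow> 'b::{banach, second_countable_topology}"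
  assumes [measurable]: "f \<in> borel_measurable borel"
  shows "(\<integral>x. f (x + c) \<partial>lborel) = (\<integral>x. f x \<partial>lborel)"
  by (subst (2) lborel_distr_plus[of c, symmetric]) (simp add: integral_distr add.commute)

lemma integrable_lborel_translate:
  fixes c :: "'a::euclidean_space" and f :: "'a \<Rightarrow> 'b::{banach, second_countable_topology}"
  assumes [measurable]: "f \<in> borel_measurable borel"
  shows "integrable lborel (\<lambda>x. f (x + c)) \<longleftrightarrow> integrable lborel f"
  by (subst (2) lborel_distr_plus[of c, symmetric]) (simp add: integrable_distr_eq add.commute)

text \<open>Moves membership from the completed measure to \<open>lborel\<close>, on which Fubini
  and the translation lemmas are used.\<close>

lemma L2_borel_iff:
  fixes u :: "real^'n \<Rightarrow> 'b::euclidean_space"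
  assumes [measurable]: "u \<in> borel_measurable borel"
  shows "u \<in> L2 \<longleftrightarrow> integrable lborel (\<lambda>x. (norm (u x))\<^sup>2)"
  by (auto simp: L2_def integrable_completion measurable_completion)

lemma tensor_shift: "tensor \<phi> (x - s *\<^sub>R axis i 1) = tensor (\<phi>(i := (\<lambda>r. \<phi> i (r - s)))) x"
  unfolding tensor_upd unfolding tensor_def
  by (subst prod.remove[of UNIV i]) (auto intro!: prod.cong simp: axis_def)

section \<open>Averages over a segment of a coordinate axis\<close>

definition window :: "real \<Rightarrow> (real \<Rightarrow> real) \<Rightarrow> real \<Rightarrow> real" where
  "window t f r = (\<integral>s. indicator {0..t} s * f (r - s) \<partial>lborel)"

text \<open>The window is the convolution of \<open>f\<close> with the indicator of [0, t]. An
  antiderivative \<open>P\<close> of \<open>f\<close> gives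
  \<open>window t f r = P r - P (r - t)\<close>, and both claims are read off from this
  formula.\<close>

lemma window_props:
  assumes f: "smooth f" and t: "0 \<le> t"
  shows "smooth (window t f)" "deriv (window t f) r = f r - f (r - t)"
proof -
  have cont: "isCont f x" for x
    using smooth_continuous[OF f] by (simp add: continuous_on_eq_continuous_at)
  then obtain P where P: "\<And>x. (P has_real_derivative f x) (at x)"
    using einterval_antiderivative[of "-\<infinity>" "\<infinity>" f] by (auto simp: has_real_derivative_iff_has_vector_derivative)
  have "window t f r = P r - P (r - t)" for r
  proof -
    have "((\<lambda>s. - P (r - s)) has_real_derivative f (r - s)) (at s)" for s
      by (auto intro!: derivative_eq_intros DERIV_chain2[OF P])
    moreover have "isCont (\<lambda>s. f (r - s)) s" for s
      by (intro continuous_intros isCont_o2[OF _ cont])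
    ultimately have "(\<integral>s. f (r - s) * indicator {0..t} s \<partial>lborel) = - P (r - t) - (- P (r - 0))"
      using t by (intro integral_FTC_Icc_real) auto
    then show ?thesis by (simp add: window_def mult.commute)
  qed
  then have eq: "window t f = (\<lambda>r. P r - P (r - t))" by auto
  have "smooth P" using smooth_antiderivative[OF f P] .
  then show "smooth (window t f)"
    unfolding eq using smooth_diff smooth_affine[of P 1 1 "- t"] by simp
  have "((\<lambda>r. P r - P (r - t)) has_real_derivative f r - f (r - t)) (at r)"
    by (auto intro!: derivative_eq_intros P DERIV_chain2[OF P])
  then show "deriv (window t f) r = f r - f (r - t)"
    unfolding eq by (rule DERIV_imp_deriv)
qed

lemma window_eq_0:
  assumes "\<And>r. r \<notin> {a..b} \<Longrightarrow> f r = 0" "r \<notin> {a..b + t}"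
  shows "window t f r = 0"
proof -
  have "(\<lambda>s. indicator {0..t} s * f (r - s)) = (\<lambda>_. 0)"
    using assms by (auto simp: indicator_def fun_eq_iff)
  then show ?thesis unfolding window_def by (simp only: Bochner_Integration.integral_zero)
qed

lemma test_factors_window:
  assumes "test_factors \<phi>" "0 \<le> t"
  shows "test_factors (\<phi>(i := window t (\<phi> i)))"
proof -
  obtain a b where ab: "\<forall>i t. t \<notin> {a i..b i} \<longrightarrow> \<phi> i t = 0"
    using assms by (auto simp: test_factors_def)
  show ?thesis
    using assms ab by (intro test_factors_upd[of _ _ "a i" "b i + t"] window_props(1) test_factors_smooth window_eq_0) auto
qed

lemma tensor_window:
  "tensor (\<phi>(i := window t (\<phi> i))) x = (\<integral>s. indicator {0..t} s * tensor \<phi> (x - s *\<^sub>R axis i 1) \<partial>lborel)"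
  unfolding tensor_shift tensor_upd window_def by (simp flip: mult.assoc)

lemma tensor_deriv_window:
  assumes "test_factors \<phi>" "0 \<le> t"
  shows "tensor (\<phi>(i := deriv (window t (\<phi> i)))) x = tensor \<phi> x - tensor \<phi> (x - t *\<^sub>R axis i 1)"
proof -
  have "tensor \<phi> x = \<phi> i (x $ i) * (\<Prod>j\<in>UNIV - {i}. \<phi> j (x $ j))"
    using tensor_upd[of \<phi> i "\<phi> i" x] by simp
  moreover have "deriv (window t (\<phi> i)) (x $ i) = \<phi> i (x $ i) - \<phi> i (x $ i - t)"
    by (rule window_props(2)[OF test_factors_smooth[OF assms(1)] assms(2)])
  ultimately show ?thesis
    unfolding tensor_shift tensor_upd by (simp add: left_diff_distrib)
qed

text \<open>Joint integrability in (x, s), needed for the uses of Fubini in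
  \<open>increment_eq_integral\<close>. The bound a n <= a + C n^2 for 0 <= a <= C separates the two
  factors, and the integral in x of either summand is unaffected by its translation. The
  coefficients \<open>\<alpha>\<close> and \<open>\<beta>\<close> cover the situations before and
  after a change of variables, where \<open>v\<close> or \<open>p\<close> is the translated
  factor.\<close>

lemma shifted_product_integrable:
  fixes p :: "real^'n \<Rightarrow> real" and v :: "real^'n \<Rightarrow> 'b::euclidean_space"
  assumes [measurable]: "p \<in> borel_measurable borel" "v \<in> borel_measurable borel"
    and C: "\<And>x. \<bar>p x\<bar> \<le> C" and p: "integrable lborel p" and v: "integrable lborel (\<lambda>x. (norm (v x))\<^sup>2)"
  shows "integrable (lborel \<Otimes>\<^sub>M lborel)
    (\<lambda>(x, s). (indicator {0..t} s * p (x - (\<alpha> * s) *\<^sub>R e)) *\<^sub>R v (x + (\<beta> * s) *\<^sub>R e))"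
    (is "integrable _ ?f")
proof (rule integrableI_bounded)
  show "?f \<in> borel_measurable (lborel \<Otimes>\<^sub>M lborel)" by measurable
  let ?P = "\<integral>\<^sup>+x. ennreal \<bar>p x\<bar> \<partial>lborel" and ?V = "\<integral>\<^sup>+x. ennreal (C * (norm (v x))\<^sup>2) \<partial>lborel"
  have "C \<ge> 0" using C[of 0] by linarith
  have "?P < \<infinity>" using p by (simp add: integrable_iff_bounded)
  have "integrable lborel (\<lambda>x. C * (norm (v x))\<^sup>2)" using v by simp
  from this[unfolded integrable_iff_bounded] have "?V < \<infinity>"
    using \<open>C \<ge> 0\<close> by (simp add: abs_mult)
  have le: "norm (?f (x, s)) \<le> indicator {0..t} s *
      (\<bar>p (x - (\<alpha> * s) *\<^sub>R e)\<bar> + C * (norm (v (x + (\<beta> * s) *\<^sub>R e)))\<^sup>2)" for x s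
  proof -
    have *: "a * n \<le> a + C * n\<^sup>2" if "0 \<le> a" "a \<le> C" for a n :: real
    proof -
      have "0 \<le> (n - 1 / 2)\<^sup>2" by simp
      then have "n \<le> 1 + n\<^sup>2" by (simp add: power2_eq_square algebra_simps)
      then have "a * n \<le> a * (1 + n\<^sup>2)" using that by (intro mult_left_mono)
      also have "\<dots> \<le> a + C * n\<^sup>2" using that by (simp add: algebra_simps mult_right_mono)
      finally show ?thesis .
    qed
    show ?thesis
      using *[OF abs_ge_zero C] by (auto simp: indicator_def)
  qed
  have "(\<integral>\<^sup>+z. norm (?f z) \<partial>(lborel \<Otimes>\<^sub>M lborel)) = (\<integral>\<^sup>+s. \<integral>\<^sup>+x. norm (?f (x, s)) \<partial>lborel \<partial>lborel)"
    by (subst lborel_pair.nn_integral_snd[symmetric]) simp_all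
  also have "\<dots> \<le> (\<integral>\<^sup>+s. indicator {0..t} s * (?P + ?V) \<partial>lborel)"
  proof (rule nn_integral_mono)
    fix s :: real
    have "(\<integral>\<^sup>+x. norm (?f (x, s)) \<partial>lborel) \<le> (\<integral>\<^sup>+x. indicator {0..t} s *
      (ennreal \<bar>p (x + - ((\<alpha> * s) *\<^sub>R e))\<bar> + ennreal (C * (norm (v (x + (\<beta> * s) *\<^sub>R e)))\<^sup>2)) \<partial>lborel)"
    proof (rule nn_integral_mono)
      fix x
      have "indicator {0..t} s * (ennreal \<bar>p (x + - ((\<alpha> * s) *\<^sub>R e))\<bar> + ennreal (C * (norm (v (x + (\<beta> * s) *\<^sub>R e)))\<^sup>2))
          = ennreal (indicator {0..t} s * (\<bar>p (x - (\<alpha> * s) *\<^sub>R e)\<bar> + C * (norm (v (x + (\<beta> * s) *\<^sub>R e)))\<^sup>2))"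
        using \<open>C \<ge> 0\<close> by (cases "s \<in> {0..t}") (simp_all add: ennreal_plus)
      then show "ennreal (norm (?f (x, s))) \<le> indicator {0..t} s *
          (ennreal \<bar>p (x + - ((\<alpha> * s) *\<^sub>R e))\<bar> + ennreal (C * (norm (v (x + (\<beta> * s) *\<^sub>R e)))\<^sup>2))"
        using ennreal_leI[OF le[of x s]] by (simp only:)
    qed
    also have "\<dots> = indicator {0..t} s * (?P + ?V)"
      by (simp add: nn_integral_cmult nn_integral_add
          nn_integral_lborel_translate[of "\<lambda>x. ennreal \<bar>p x\<bar>" "- ((\<alpha> * s) *\<^sub>R e)", simplified]
          nn_integral_lborel_translate[of "\<lambda>x. ennreal (C * (norm (v x))\<^sup>2)"])
    finally show "(\<integral>\<^sup>+x. norm (?f (x, s)) \<partial>lborel) \<le> indicator {0..t} s * (?P + ?V)" .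
  qed
  also have "\<dots> = emeasure lborel {0..t} * (?P + ?V)"
    by (simp add: nn_integral_multc)
  also have "\<dots> < \<infinity>"
    using \<open>?P < \<infinity>\<close> \<open>?V < \<infinity>\<close> by (simp add: ennreal_mult_less_top emeasure_lborel_Icc_eq)
  finally show "(\<integral>\<^sup>+z. norm (?f z) \<partial>(lborel \<Otimes>\<^sub>M lborel)) < \<infinity>" .
qed

text \<open>
  The fundamental theorem of calculus along a coordinate axis for a weak derivative: testing with
  the average of \<open>\<phi>\<close> over the segment moves the increment of \<open>u\<close> to an integral of \<open>v\<close>.
\<close>

lemma increment_eq_integral:
  fixes u v :: "real^'n \<Rightarrow> 'b::euclidean_space"
  assumes [measurable]: "u \<in> borel_measurable borel" "v \<in> borel_measurable borel"
    and u: "u \<in> L2" and v: "v \<in> L2" and t: "0 \<le> t"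
    and weak: "\<And>\<phi>. test_factors \<phi> \<Longrightarrow>
      (\<integral>x. tensor (\<phi>(i := deriv (\<phi> i))) x *\<^sub>R u x \<partial>lborel) = - (\<integral>x. tensor \<phi> x *\<^sub>R v x \<partial>lborel)"
  shows "AE x in lborel. u (x + t *\<^sub>R axis i 1) - u x
    = (\<integral>s. indicator {0..t} s *\<^sub>R v (x + s *\<^sub>R axis i 1) \<partial>lborel)"
proof -
  let ?e = "axis i 1 :: real^'n"
  define G where "G x = (\<integral>s. indicator {0..t} s *\<^sub>R v (x + s *\<^sub>R ?e) \<partial>lborel)" for x
  have [measurable]: "G \<in> borel_measurable borel" unfolding G_def by measurable
  have v2: "integrable lborel (\<lambda>x. (norm (v x))\<^sup>2)" using v by (simp add: L2_borel_iff)
  have tu: "(\<lambda>x. u (x + t *\<^sub>R ?e)) \<in> L2"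
    using u integrable_lborel_translate[of "\<lambda>x. (norm (u x))\<^sup>2"] by (simp add: L2_borel_iff)
  have G_int: "set_integrable lebesgue (cbox a b) G" for a b
  proof -
    have "integrable lborel (indicator (cbox a b) :: real^'n \<Rightarrow> real)"
      by (rule integrable_real_indicator) (auto simp: emeasure_lborel_cbox_eq)
    \<comment> \<open>Local integrability of \<open>G\<close> is the joint integrability with the
      indicator of the box in the place of \<open>p\<close>, integrated in \<open>s\<close>.\<close>
    from lborel_pair.integrable_fst[OF shifted_product_integrable[OF _ _ _ this v2, of 1 t 0 ?e 1]]
    have "integrable lborel (\<lambda>x. \<integral>s. (indicator {0..t} s * indicator (cbox a b) x) *\<^sub>R v (x + s *\<^sub>R ?e) \<partial>lborel)"
      by (simp add: indicator_def)
    also have "(\<lambda>x. \<integral>s. (indicator {0..t} s * indicator (cbox a b) x) *\<^sub>R v (x + s *\<^sub>R ?e) \<partial>lborel)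
        = (\<lambda>x. indicator (cbox a b) x *\<^sub>R G x)"
      unfolding G_def
      by (simp only: mult.commute[of "indicator {0..t} _"] scaleR_scaleR[symmetric] integral_scaleR_right)
    finally show ?thesis by (simp add: set_integrable_def integrable_completion)
  qed
  have loc: "set_integrable lebesgue (cbox a b) (\<lambda>x. u (x + t *\<^sub>R ?e) - u x - G x)" for a b
    by (intro set_integral_diff(1) G_int L2_locally_integrable tu u)
  have "AE x in lebesgue. u (x + t *\<^sub>R ?e) - u x - G x = 0"
  proof (rule AE_eq_0_if_tensor_integrals_0[OF loc])
    fix \<phi> :: "'n \<Rightarrow> real \<Rightarrow> real" assume \<phi>: "test_factors \<phi>"
    note [measurable] = borel_measurable_tensor[OF \<phi>]
    obtain C where C: "\<And>x. \<bar>tensor \<phi> x\<bar> \<le> C" using tensor_bounded[OF \<phi>] by blast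
    note joint = shifted_product_integrable[OF _ _ C tensor_integrable[OF \<phi>] v2, of t]
    have "(\<integral>x. tensor \<phi> x *\<^sub>R G x \<partial>lborel)
        = (\<integral>x. \<integral>s. (indicator {0..t} s * tensor \<phi> x) *\<^sub>R v (x + s *\<^sub>R ?e) \<partial>lborel \<partial>lborel)"
      unfolding G_def by (simp add: mult.commute flip: scaleR_scaleR)
    also have "\<dots> = (\<integral>s. \<integral>x. (indicator {0..t} s * tensor \<phi> x) *\<^sub>R v (x + s *\<^sub>R ?e) \<partial>lborel \<partial>lborel)"
      using joint[of 0 ?e 1] by (intro lborel_pair.Fubini_integral[symmetric]) simp
    also have "\<dots> = (\<integral>s. \<integral>x. (indicator {0..t} s * tensor \<phi> (x - s *\<^sub>R ?e)) *\<^sub>R v x \<partial>lborel \<partial>lborel)"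
    proof (rule Bochner_Integration.integral_cong[OF refl])
      fix s :: real
      show "(\<integral>x. (indicator {0..t} s * tensor \<phi> x) *\<^sub>R v (x + s *\<^sub>R ?e) \<partial>lborel)
        = (\<integral>x. (indicator {0..t} s * tensor \<phi> (x - s *\<^sub>R ?e)) *\<^sub>R v x \<partial>lborel)"
        using integral_lborel_translate[of "\<lambda>x. (indicator {0..t} s * tensor \<phi> (x - s *\<^sub>R ?e)) *\<^sub>R v x" "s *\<^sub>R ?e"]
        by simp
    qed
    also have "\<dots> = (\<integral>x. \<integral>s. (indicator {0..t} s * tensor \<phi> (x - s *\<^sub>R ?e)) *\<^sub>R v x \<partial>lborel \<partial>lborel)"
      using joint[of 1 ?e 0] by (intro lborel_pair.Fubini_integral) simp
    also have "\<dots> = (\<integral>x. tensor (\<phi>(i := window t (\<phi> i))) x *\<^sub>R v x \<partial>lborel)"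
    proof (rule Bochner_Integration.integral_cong[OF refl])
      fix x
      have "integrable lborel (\<lambda>s. indicator {0..t} s *\<^sub>R tensor \<phi> (x - s *\<^sub>R ?e))"
        by (intro borel_integrable_compact continuous_intros
            continuous_on_compose2[OF continuous_on_tensor[of \<phi> UNIV]] test_factors_smooth[OF \<phi>]) auto
      then show "(\<integral>s. (indicator {0..t} s * tensor \<phi> (x - s *\<^sub>R ?e)) *\<^sub>R v x \<partial>lborel)
          = tensor (\<phi>(i := window t (\<phi> i))) x *\<^sub>R v x"
        unfolding tensor_window by (simp add: integral_scaleR_left)
    qed
    \<comment> \<open>The weak derivative enters here: \<open>\<phi>\<close> with its factor
      \<open>i\<close> averaged is again a family of test factors, and the derivative of its product
      in direction \<open>i\<close> is a difference of \<open>tensor \<phi>\<close> and its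
      translate.\<close>
    also have "\<dots> = - (\<integral>x. tensor (\<phi>(i := deriv (window t (\<phi> i)))) x *\<^sub>R u x \<partial>lborel)"
      using weak[OF test_factors_window[OF \<phi> t, of i]] by simp
    also have "(\<integral>x. tensor (\<phi>(i := deriv (window t (\<phi> i)))) x *\<^sub>R u x \<partial>lborel)
        = (\<integral>x. tensor \<phi> x *\<^sub>R u x - tensor \<phi> (x - t *\<^sub>R ?e) *\<^sub>R u x \<partial>lborel)"
      by (simp add: tensor_deriv_window[OF \<phi> t] scaleR_diff_left)
    finally have G_eq: "(\<integral>x. tensor \<phi> x *\<^sub>R G x \<partial>lborel)
      = - (\<integral>x. tensor \<phi> x *\<^sub>R u x - tensor \<phi> (x - t *\<^sub>R ?e) *\<^sub>R u x \<partial>lborel)" .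
    have iu: "integrable lborel (\<lambda>x. tensor \<phi> x *\<^sub>R u x)"
      using tensor_scaleR_integrable[OF L2_locally_integrable[OF u] \<phi>] by (simp add: integrable_completion)
    have itu: "integrable lborel (\<lambda>x. tensor \<phi> x *\<^sub>R u (x + t *\<^sub>R ?e))"
      using tensor_scaleR_integrable[OF L2_locally_integrable[OF tu] \<phi>] by (simp add: integrable_completion)
    have iG: "integrable lborel (\<lambda>x. tensor \<phi> x *\<^sub>R G x)"
      using tensor_scaleR_integrable[OF G_int \<phi>] by (simp add: integrable_completion)
    \<comment> \<open>A change of variables moves the translation from the test function back to
      \<open>u\<close>.\<close>
    have its: "integrable lborel (\<lambda>x. tensor \<phi> (x - t *\<^sub>R ?e) *\<^sub>R u x)"
      and shift: "(\<integral>x. tensor \<phi> (x - t *\<^sub>R ?e) *\<^sub>R u x \<partial>lborel) = (\<integral>x. tensor \<phi> x *\<^sub>R u (x + t *\<^sub>R ?e) \<partial>lborel)"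
      using integrable_lborel_translate[of "\<lambda>x. tensor \<phi> (x - t *\<^sub>R ?e) *\<^sub>R u x" "t *\<^sub>R ?e"]
        integral_lborel_translate[of "\<lambda>x. tensor \<phi> (x - t *\<^sub>R ?e) *\<^sub>R u x" "t *\<^sub>R ?e"] itu by auto
    have "(\<integral>x. tensor \<phi> x *\<^sub>R (u (x + t *\<^sub>R ?e) - u x - G x) \<partial>lborel) = 0"
      using G_eq iu itu iG its shift by (simp add: scaleR_diff_right)
    then show "(\<integral>x. tensor \<phi> x *\<^sub>R (u (x + t *\<^sub>R ?e) - u x - G x) \<partial>lebesgue) = 0"
      by (simp add: integral_completion)
  qed
  then show ?thesis
    unfolding G_def by (simp add: AE_completion_iff)
qed

text \<open>By Cauchy-Schwarz on [0, t] the square of the segment integral is at most t times the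
  integral of |v|^2 over the segment. After integration in x each s contributes the full mass of
  \<open>v\<close>, which gives the second factor t.\<close>

lemma increment_L2_bound:
  fixes u v :: "real^'n \<Rightarrow> 'b::euclidean_space"
  assumes [measurable]: "u \<in> borel_measurable borel" "v \<in> borel_measurable borel"
    and u: "u \<in> L2" and v: "v \<in> L2" and t: "0 \<le> t"
    and weak: "\<And>\<phi>. test_factors \<phi> \<Longrightarrow>
      (\<integral>x. tensor (\<phi>(i := deriv (\<phi> i))) x *\<^sub>R u x \<partial>lborel) = - (\<integral>x. tensor \<phi> x *\<^sub>R v x \<partial>lborel)"
  shows "(\<integral>\<^sup>+x. ennreal ((norm (u (x + t *\<^sub>R axis i 1) - u x))\<^sup>2) \<partial>lborel)
    \<le> ennreal (t\<^sup>2) * (\<integral>\<^sup>+x. ennreal ((norm (v x))\<^sup>2) \<partial>lborel)"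
proof -
  let ?e = "axis i 1 :: real^'n" and ?I = "\<lambda>s. indicator {0..t} s :: ennreal"
  let ?V = "\<integral>\<^sup>+x. ennreal ((norm (v x))\<^sup>2) \<partial>lborel"
  have I2: "(?I s)\<^sup>2 = ?I s" for s by (simp add: indicator_def)
  have I: "(\<integral>\<^sup>+s. ?I s \<partial>lborel) = ennreal t" using t by simp
  have bound: "ennreal ((norm (\<integral>s. indicator {0..t} s *\<^sub>R v (x + s *\<^sub>R ?e) \<partial>lborel))\<^sup>2)
      \<le> ennreal t * (\<integral>\<^sup>+s. ?I s * ennreal ((norm (v (x + s *\<^sub>R ?e)))\<^sup>2) \<partial>lborel)" for x
  proof -
    let ?w = "\<lambda>s. indicator {0..t} s *\<^sub>R v (x + s *\<^sub>R ?e)"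
    \<comment> \<open>If \<open>?w\<close> is not integrable, its Bochner integral is 0 and the
      bound is trivial.\<close>
    have "ennreal (norm (\<integral>s. ?w s \<partial>lborel)) \<le> (\<integral>\<^sup>+s. norm (?w s) \<partial>lborel)"
      by (cases "integrable lborel ?w")
         (simp_all add: integral_norm_bound_ennreal not_integrable_integral_eq del: norm_scaleR)
    \<comment> \<open>The indicator is its own square; one copy serves as the constant factor in
      Cauchy-Schwarz.\<close>
    also have "\<dots> = (\<integral>\<^sup>+s. ?I s * (?I s * ennreal (norm (v (x + s *\<^sub>R ?e)))) \<partial>lborel)"
      by (intro nn_integral_cong) (simp add: indicator_def)
    finally have "(ennreal (norm (\<integral>s. ?w s \<partial>lborel)))\<^sup>2
        \<le> (\<integral>\<^sup>+s. ?I s * (?I s * ennreal (norm (v (x + s *\<^sub>R ?e)))) \<partial>lborel)\<^sup>2"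
      by (intro power_mono_ennreal)
    also have "\<dots> \<le> (\<integral>\<^sup>+s. (?I s)\<^sup>2 \<partial>lborel) * (\<integral>\<^sup>+s. (?I s * ennreal (norm (v (x + s *\<^sub>R ?e))))\<^sup>2 \<partial>lborel)"
      by (intro Cauchy_Schwarz_nn_integral) measurable
    finally show ?thesis
      by (simp only: I2 I power_mult_distrib ennreal_power norm_ge_zero)
  qed
  have "(\<integral>\<^sup>+x. ennreal ((norm (u (x + t *\<^sub>R ?e) - u x))\<^sup>2) \<partial>lborel)
      \<le> (\<integral>\<^sup>+x. ennreal t * (\<integral>\<^sup>+s. ?I s * ennreal ((norm (v (x + s *\<^sub>R ?e)))\<^sup>2) \<partial>lborel) \<partial>lborel)"
  proof (rule nn_integral_mono_AE)
    have eq: "AE x in lborel. u (x + t *\<^sub>R ?e) - u x = (\<integral>s. indicator {0..t} s *\<^sub>R v (x + s *\<^sub>R ?e) \<partial>lborel)"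
      by (rule increment_eq_integral[OF assms(1-5)]) (rule weak)
    show "AE x in lborel. ennreal ((norm (u (x + t *\<^sub>R ?e) - u x))\<^sup>2)
      \<le> ennreal t * (\<integral>\<^sup>+s. ?I s * ennreal ((norm (v (x + s *\<^sub>R ?e)))\<^sup>2) \<partial>lborel)"
      using eq by eventually_elim (simp only: bound)
  qed
  also have "\<dots> = ennreal t * (\<integral>\<^sup>+x. \<integral>\<^sup>+s. ?I s * ennreal ((norm (v (x + s *\<^sub>R ?e)))\<^sup>2) \<partial>lborel \<partial>lborel)"
    by (rule nn_integral_cmult) measurable
  also have "(\<integral>\<^sup>+x. \<integral>\<^sup>+s. ?I s * ennreal ((norm (v (x + s *\<^sub>R ?e)))\<^sup>2) \<partial>lborel \<partial>lborel)
      = (\<integral>\<^sup>+s. \<integral>\<^sup>+x. ?I s * ennreal ((norm (v (x + s *\<^sub>R ?e)))\<^sup>2) \<partial>lborel \<partial>lborel)"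
    by (rule lborel_pair.Fubini'[symmetric]) measurable
  also have "\<dots> = (\<integral>\<^sup>+s. ?I s * ?V \<partial>lborel)"
    by (simp add: nn_integral_cmult nn_integral_lborel_translate[of "\<lambda>x. ennreal ((norm (v x))\<^sup>2)"])
  also have "\<dots> = ennreal t * ?V"
    by (simp add: nn_integral_multc I)
  finally show ?thesis
    using t by (simp add: power2_eq_square ennreal_mult mult.assoc)
qed

section \<open>From increments along the axes to the mass above a level\<close>

definition increment :: "(real^'n \<Rightarrow> 'b::euclidean_space) \<Rightarrow> real^'n \<Rightarrow> ennreal" where
  "increment u y = (\<integral>\<^sup>+x. ennreal ((norm (u (x + y) - u x))\<^sup>2) \<partial>lborel)"

text \<open>The way from x to x + a + b passes through x + b. The increment over \<open>a\<close>
  then starts at x + b, and a translation brings it back to x; the factors 2 come from squaring a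
  sum.\<close>

lemma increment_add_le:
  fixes u :: "real^'n \<Rightarrow> 'b::euclidean_space"
  assumes [measurable]: "u \<in> borel_measurable borel"
  shows "increment u (a + b) \<le> 2 * increment u a + 2 * increment u b"
proof -
  have "increment u (a + b) \<le> (\<integral>\<^sup>+x. 2 * ennreal ((norm (u ((x + b) + a) - u (x + b)))\<^sup>2)
      + 2 * ennreal ((norm (u (x + b) - u x))\<^sup>2) \<partial>lborel)"
    unfolding increment_def
  proof (rule nn_integral_mono)
    fix x
    have "(norm (u (x + (a + b)) - u x))\<^sup>2 \<le> 2 * (norm (u ((x + b) + a) - u (x + b)))\<^sup>2 + 2 * (norm (u (x + b) - u x))\<^sup>2"
      using norm_add_sq_le[of "u ((x + b) + a) - u (x + b)" "u (x + b) - u x"] by (simp add: add_ac)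
    then have "ennreal ((norm (u (x + (a + b)) - u x))\<^sup>2)
      \<le> ennreal (2 * (norm (u ((x + b) + a) - u (x + b)))\<^sup>2 + 2 * (norm (u (x + b) - u x))\<^sup>2)"
      by (rule ennreal_leI)
    then show "ennreal ((norm (u (x + (a + b)) - u x))\<^sup>2)
      \<le> 2 * ennreal ((norm (u ((x + b) + a) - u (x + b)))\<^sup>2) + 2 * ennreal ((norm (u (x + b) - u x))\<^sup>2)"
      by (simp add: ennreal_plus ennreal_mult)
  qed
  also have "\<dots> = 2 * increment u a + 2 * increment u b"
    using nn_integral_lborel_translate[of "\<lambda>x. ennreal ((norm (u (x + a) - u x))\<^sup>2)" b]
    by (simp add: increment_def nn_integral_add nn_integral_cmult)
  finally show ?thesis .
qed

text \<open>The vector is traversed one coordinate at a time. Each further coordinate costs a factor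
  4, namely 2 + 2 from \<open>increment_add_le\<close>, once the bound for the single step is
  enlarged to the bound for the rest.\<close>

lemma increment_sum_le:
  fixes u :: "real^'n \<Rightarrow> 'b::euclidean_space"
  assumes u: "u \<in> borel_measurable borel"
    and W: "\<And>i t. 0 \<le> t \<Longrightarrow> increment u (t *\<^sub>R axis i 1) \<le> ennreal (t\<^sup>2) * W"
    and y: "\<And>i. 0 \<le> y i" "\<And>i. y i \<le> \<epsilon>" and S: "finite S"
  shows "increment u (\<Sum>i\<in>S. y i *\<^sub>R axis i 1) \<le> 4 ^ card S * (ennreal (\<epsilon>\<^sup>2) * W)"
  using S
proof (induction S rule: finite_induct)
  case empty
  then show ?case by (simp add: increment_def)
next
  case (insert i S)
  let ?c = "ennreal (\<epsilon>\<^sup>2) * W"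
  have "increment u (y i *\<^sub>R axis i 1) \<le> ennreal ((y i)\<^sup>2) * W" using y W by simp
  also have "\<dots> \<le> ?c" using y by (intro mult_right_mono ennreal_leI power_mono) auto
  also have "\<dots> \<le> 4 ^ card S * ?c"
  proof -
    have "1 \<le> (4 ^ card S :: ennreal)" by (rule one_le_power) simp
    then show ?thesis using mult_right_mono[of 1 "4 ^ card S" ?c] by simp
  qed
  finally have "increment u (y i *\<^sub>R axis i 1 + (\<Sum>i\<in>S. y i *\<^sub>R axis i 1)) \<le> 2 * (4 ^ card S * ?c) + 2 * (4 ^ card S * ?c)"
    using insert.IH by (intro order_trans[OF increment_add_le[OF u]] add_mono mult_left_mono) auto
  also have "\<dots> = 4 ^ card (insert i S) * ?c"
    using insert.hyps by (simp add: mult.assoc[symmetric] distrib_right[symmetric])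
  finally show ?case using insert.hyps by simp
qed

text \<open>
  Averaging over the cube \<open>Q\<close> of side \<open>\<epsilon>\<close>: where \<open>|u|\<^sup>2\<close> exceeds four times the largest possible
  mean of \<open>|u|\<^sup>2\<close> over a translate of \<open>Q\<close>, it is controlled by the mean of \<open>|u(x + y) - u(x)|\<^sup>2\<close>.
\<close>

lemma tail_bound:
  fixes u :: "real^'n \<Rightarrow> 'b::euclidean_space"
  assumes [measurable]: "u \<in> borel_measurable borel"
    and W: "\<And>i t. 0 \<le> t \<Longrightarrow> increment u (t *\<^sub>R axis i 1) \<le> ennreal (t\<^sup>2) * W"
    and K: "(\<integral>\<^sup>+x. ennreal ((norm (u x))\<^sup>2) \<partial>lborel) \<le> ennreal K" "0 \<le> K" and \<epsilon>: "0 < \<epsilon>"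
  shows "(\<integral>\<^sup>+x. ennreal ((norm (u x))\<^sup>2) * indicator {x. 4 * K < \<epsilon> ^ CARD('n) * (norm (u x))\<^sup>2} x \<partial>lborel)
    \<le> 4 * (4 ^ CARD('n) * (ennreal (\<epsilon>\<^sup>2) * W))"
proof -
  let ?Q = "cbox 0 (\<chi> i. \<epsilon>) :: (real^'n) set"
  let ?E = "{x. 4 * K < \<epsilon> ^ CARD('n) * (norm (u x))\<^sup>2}"
  let ?C = "4 ^ CARD('n) * (ennreal (\<epsilon>\<^sup>2) * W)"
  have "?Q \<noteq> {}" using \<epsilon> by (simp add: interval_ne_empty_cart)
  then have "measure lborel ?Q = \<epsilon> ^ CARD('n)"
    by (simp add: content_cbox_cart)
  moreover have "emeasure lborel ?Q \<noteq> top"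
    using emeasure_lborel_cbox_finite[of 0 "(\<chi> i. \<epsilon>) :: real^'n"] by simp
  ultimately have Q: "emeasure lborel ?Q = ennreal (\<epsilon> ^ CARD('n))"
    by (simp add: emeasure_eq_ennreal_measure)
  have inc: "increment u y \<le> ?C" if "y \<in> ?Q" for y
  proof -
    have "(\<Sum>i\<in>UNIV. y $ i *\<^sub>R axis i 1) = y"
      using basis_expansion[of y] by (simp add: scalar_mult_eq_scaleR)
    then show ?thesis
      using increment_sum_le[OF assms(1) W, of "\<lambda>i. y $ i" \<epsilon> UNIV] that by (simp add: mem_box_cart)
  qed
  define A where "A x = (\<integral>\<^sup>+y. indicator ?Q y * ennreal ((norm (u (x + y) - u x))\<^sup>2) \<partial>lborel)" for x
  \<comment> \<open>For \<open>x\<close> in \<open>?E\<close> the inequality |u(x)|^2 <= 2 |u(x + y)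
    - u(x)|^2 + 2 |u(x + y)|^2 is integrated over \<open>y\<close> in \<open>?Q\<close>. The case of
    infinite \<open>A x\<close> is split off so that the absorption takes place in the
    reals.\<close>
  have pointwise: "ennreal (\<epsilon> ^ CARD('n)) * (ennreal ((norm (u x))\<^sup>2) * indicator ?E x) \<le> 4 * A x" for x
  proof (cases "x \<in> ?E \<and> A x < \<infinity>")
    case True
    then obtain a where a: "A x = ennreal a" "0 \<le> a" by (cases "A x") auto
    have "ennreal (\<epsilon> ^ CARD('n)) * ennreal ((norm (u x))\<^sup>2) = (\<integral>\<^sup>+y. indicator ?Q y * ennreal ((norm (u x))\<^sup>2) \<partial>lborel)"
      by (simp add: nn_integral_multc Q)
    \<comment> \<open>In the second term the cube is enlarged to the whole space, where the mass is
      at most \<open>K\<close>.\<close>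
    also have "\<dots> \<le> (\<integral>\<^sup>+y. 2 * (indicator ?Q y * ennreal ((norm (u (x + y) - u x))\<^sup>2)) + 2 * ennreal ((norm (u (y + x)))\<^sup>2) \<partial>lborel)"
    proof (rule nn_integral_mono)
      fix y
      have "(norm (u x))\<^sup>2 \<le> 2 * (norm (u (x + y) - u x))\<^sup>2 + 2 * (norm (u (y + x)))\<^sup>2"
        using norm_add_sq_le[of "u x - u (x + y)" "u (y + x)"] by (simp add: add.commute norm_minus_commute)
      then have "ennreal ((norm (u x))\<^sup>2) \<le> 2 * ennreal ((norm (u (x + y) - u x))\<^sup>2) + 2 * ennreal ((norm (u (y + x)))\<^sup>2)"
        by (auto dest!: ennreal_leI simp: ennreal_plus ennreal_mult)
      then show "indicator ?Q y * ennreal ((norm (u x))\<^sup>2) \<le> 2 * (indicator ?Q y * ennreal ((norm (u (x + y) - u x))\<^sup>2)) + 2 * ennreal ((norm (u (y + x)))\<^sup>2)"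
        by (simp add: indicator_def)
    qed
    also have "\<dots> = 2 * A x + 2 * (\<integral>\<^sup>+y. ennreal ((norm (u y))\<^sup>2) \<partial>lborel)"
      by (simp add: A_def nn_integral_add nn_integral_cmult nn_integral_lborel_translate[of "\<lambda>y. ennreal ((norm (u y))\<^sup>2)"])
    also have "\<dots> \<le> 2 * ennreal a + 2 * ennreal K"
      using a K by (intro add_mono mult_left_mono) auto
    also have "\<dots> = ennreal (2 * a + 2 * K)"
      using a K by (simp add: ennreal_plus ennreal_mult)
    finally have "ennreal (\<epsilon> ^ CARD('n) * (norm (u x))\<^sup>2) \<le> ennreal (2 * a + 2 * K)"
      using \<epsilon> by (simp only: ennreal_mult zero_le_power less_imp_le zero_le_power2)
    then have "\<epsilon> ^ CARD('n) * (norm (u x))\<^sup>2 \<le> 2 * a + 2 * K"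
      using a K by (simp only: ennreal_le_iff add_nonneg_nonneg mult_nonneg_nonneg zero_le_numeral)
    \<comment> \<open>On \<open>?E\<close> the term 2 K is less than half of the left side;
      absorbing it turns 2 a into 4 a.\<close>
    then have "\<epsilon> ^ CARD('n) * (norm (u x))\<^sup>2 \<le> 4 * a" using True by simp
    then have "ennreal (\<epsilon> ^ CARD('n) * (norm (u x))\<^sup>2) \<le> ennreal (4 * a)" by (rule ennreal_leI)
    then show ?thesis using True \<epsilon> a by (simp add: ennreal_mult)
  next
    case False
    then consider "x \<notin> ?E" | "A x = top" using less_top[of "A x"] by auto
    then show ?thesis by cases (simp_all add: ennreal_mult_top)
  qed
  have "ennreal (\<epsilon> ^ CARD('n)) * (\<integral>\<^sup>+x. ennreal ((norm (u x))\<^sup>2) * indicator ?E x \<partial>lborel)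
      = (\<integral>\<^sup>+x. ennreal (\<epsilon> ^ CARD('n)) * (ennreal ((norm (u x))\<^sup>2) * indicator ?E x) \<partial>lborel)"
    by (rule nn_integral_cmult[symmetric]) measurable
  also have "\<dots> \<le> (\<integral>\<^sup>+x. 4 * A x \<partial>lborel)"
    by (intro nn_integral_mono pointwise)
  also have "\<dots> = 4 * (\<integral>\<^sup>+x. A x \<partial>lborel)"
    unfolding A_def by (rule nn_integral_cmult) measurable
  \<comment> \<open>After the exchange of integrals each \<open>y\<close> in \<open>?Q\<close>
    contributes at most \<open>?C\<close>, so that the volume of the cube appears on both sides and
    cancels.\<close>
  also have "(\<integral>\<^sup>+x. A x \<partial>lborel) = (\<integral>\<^sup>+y. \<integral>\<^sup>+x. indicator ?Q y * ennreal ((norm (u (x + y) - u x))\<^sup>2) \<partial>lborel \<partial>lborel)"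
    unfolding A_def by (rule lborel_pair.Fubini'[symmetric]) measurable
  also have "\<dots> = (\<integral>\<^sup>+y. indicator ?Q y * increment u y \<partial>lborel)"
    unfolding increment_def by (intro nn_integral_cong nn_integral_cmult) measurable
  also have "\<dots> \<le> (\<integral>\<^sup>+y. indicator ?Q y * ?C \<partial>lborel)"
    using inc by (intro nn_integral_mono) (auto simp: indicator_def)
  also have "\<dots> = ennreal (\<epsilon> ^ CARD('n)) * ?C"
    by (simp add: nn_integral_multc Q)
  finally have "ennreal (\<epsilon> ^ CARD('n)) * (\<integral>\<^sup>+x. ennreal ((norm (u x))\<^sup>2) * indicator ?E x \<partial>lborel)
      \<le> ennreal (\<epsilon> ^ CARD('n)) * (4 * ?C)"
    by (simp add: mult_left_mono mult.left_commute)
  then show ?thesis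
    using \<epsilon> by (subst (asm) ennreal_mult_le_mult_iff) auto
qed

section \<open>Integrability of the logarithmic term\<close>

text \<open>The Gaussian factorises over the coordinates into one-dimensional normal densities, up
  to a constant.\<close>

lemma gaussian_integrable: "integrable lborel (\<lambda>x :: real^'n. exp (- (norm x)\<^sup>2 / 2))"
proof (rule integrableI_bounded)
  have 1: "integrable lborel (\<lambda>t::real. exp (- t\<^sup>2 / 2))"
  proof -
    have eq: "exp (- t\<^sup>2 / 2) = sqrt (2 * pi) * normal_density 0 1 t" for t
      unfolding std_normal_density_def by simp
    show ?thesis
      unfolding eq by (intro Bochner_Integration.integrable_mult_right integrable_normal_density) simp
  qed
  from this[unfolded integrable_iff_bounded]
  have "(\<integral>\<^sup>+t. ennreal (exp (- (t::real)\<^sup>2 / 2)) \<partial>lborel) < \<infinity>" by simp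
  moreover have "(\<integral>\<^sup>+(x::real^'n). ennreal (norm (exp (- (norm x)\<^sup>2 / 2))) \<partial>lborel)
      = (\<integral>\<^sup>+(x::real^'n). (\<Prod>b\<in>Basis. ennreal (exp (- (x \<bullet> b)\<^sup>2 / 2))) \<partial>lborel)"
  proof (rule nn_integral_cong)
    fix x :: "real^'n"
    have "exp (- (norm x)\<^sup>2 / 2) = (\<Prod>b\<in>Basis. exp (- (x \<bullet> b)\<^sup>2 / 2))"
    proof -
      have "- (norm x)\<^sup>2 / 2 = (\<Sum>b\<in>Basis. - (x \<bullet> b)\<^sup>2 / 2)"
        unfolding power2_norm_eq_inner euclidean_inner[of x x]
        by (simp add: power2_eq_square sum_negf flip: sum_divide_distrib)
      then show ?thesis by (simp only: exp_sum[OF finite_Basis])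
    qed
    then show "ennreal (norm (exp (- (norm x)\<^sup>2 / 2))) = (\<Prod>b\<in>Basis. ennreal (exp (- (x \<bullet> b)\<^sup>2 / 2)))"
      by (simp add: prod_ennreal abs_prod)
  qed
  moreover have "\<dots> = (\<Prod>b\<in>(Basis :: (real^'n) set). (\<integral>\<^sup>+t. ennreal (exp (- t\<^sup>2 / 2)) \<partial>lborel))"
    by (rule nn_integral_lborel_prod) auto
  ultimately show "(\<integral>\<^sup>+(x::real^'n). ennreal (norm (exp (- (norm x)\<^sup>2 / 2))) \<partial>lborel) < \<infinity>"
    by (simp add: power_less_top_ennreal)
qed measurable

text \<open>The function \<open>h\<close> is |u|^2 times the number of levels exceeded at x. Its
  integral is a sum of tail masses bounded by multiples of 4^(-k), and it dominates |u|^2 ln |u|^2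
  up to a multiple of |u|^2. Since \<open>ennreal\<close> cuts off negative values, only the part
  with |u| > 1 counts here.\<close>

lemma log_tail_integral_finite:
  fixes u :: "real^'n \<Rightarrow> 'b::euclidean_space"
  assumes [measurable]: "u \<in> borel_measurable borel" and u: "u \<in> L2"
    and W: "\<And>i t. 0 \<le> t \<Longrightarrow> increment u (t *\<^sub>R axis i 1) \<le> ennreal (t\<^sup>2) * W" "W < \<infinity>"
  shows "(\<integral>\<^sup>+x. ennreal ((norm (u x))\<^sup>2 * ln ((norm (u x))\<^sup>2)) \<partial>lborel) < \<infinity>"
proof -
  let ?U = "\<lambda>x. (norm (u x))\<^sup>2" and ?d = "CARD('n)"
  have iU: "integrable lborel ?U" using u by (simp add: L2_borel_iff)
  \<comment> \<open>The summand 1 keeps \<open>K\<close> positive even if \<open>u\<close> vanishes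
    almost everywhere; otherwise the levels would not tend to infinity and ln (4 K) would be
    meaningless.\<close>
  define K where "K = (\<integral>x. ?U x \<partial>lborel) + 1"
  have nnU: "(\<integral>\<^sup>+x. ennreal (?U x) \<partial>lborel) = ennreal (\<integral>x. ?U x \<partial>lborel)"
    by (rule nn_integral_eq_integral[OF iU]) simp
  have "0 \<le> (\<integral>x. ?U x \<partial>lborel)" by simp
  then have K: "0 < K" "(\<integral>\<^sup>+x. ennreal (?U x) \<partial>lborel) \<le> ennreal K"
    unfolding nnU by (simp_all only: K_def add_nonneg_pos zero_less_one) (simp add: ennreal_leI)
  define E where "E k = {x. 4 * K < ((1 / 2) ^ k) ^ ?d * ?U x}" for k :: nat
  define h where "h x = (\<Sum>k. ennreal (?U x) * indicator (E k) x)" for x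
  have [measurable]: "E k \<in> sets borel" for k unfolding E_def by measurable
  have "(\<integral>\<^sup>+x. h x \<partial>lborel) = (\<Sum>k. \<integral>\<^sup>+x. ennreal (?U x) * indicator (E k) x \<partial>lborel)"
    unfolding h_def by (rule nn_integral_suminf) measurable
  also have "\<dots> \<le> (\<Sum>k. (4 * 4 ^ ?d * W) * ennreal ((1 / 4) ^ k))"
  proof (rule suminf_le)
    fix k :: nat
    have "((1 / 2 :: real) ^ k)\<^sup>2 = (1 / 4) ^ k"
      by (simp add: power_mult_distrib[symmetric] power2_eq_square)
    then show "(\<integral>\<^sup>+x. ennreal (?U x) * indicator (E k) x \<partial>lborel) \<le> (4 * 4 ^ ?d * W) * ennreal ((1 / 4) ^ k)"
      using tail_bound[OF assms(1) W(1) K(2), of "(1 / 2) ^ k"] K(1) unfolding E_def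
      by (simp add: mult_ac)
  qed auto
  also have "\<dots> = (4 * 4 ^ ?d * W) * (\<Sum>k. ennreal ((1 / 4) ^ k))"
    by (rule ennreal_suminf_cmult)
  also have "\<dots> < \<infinity>"
  proof -
    have "(\<Sum>k. ennreal ((1 / 4) ^ k)) \<noteq> top"
      by (intro ennreal_suminf_neq_top summable_geometric) auto
    moreover have "4 * 4 ^ ?d * W < top"
      using W(2) by (simp add: ennreal_mult_less_top power_less_top_ennreal)
    ultimately show ?thesis
      by (simp only: ennreal_mult_less_top less_top infinity_ennreal_def simp_thms)
  qed
  finally have h: "(\<integral>\<^sup>+x. h x \<partial>lborel) < \<infinity>" .
  have [measurable]: "h \<in> borel_measurable borel" unfolding h_def by measurable
  have "ennreal (?U x * ln (?U x)) \<le> ennreal \<bar>ln (4 * K)\<bar> * ennreal (?U x) + ennreal (?d * ln 2) * h x" for x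
  proof (cases "?U x = 0")
    case False
    then have U: "?U x > 0" by simp
    have "(\<lambda>k. ((1 / 2 :: real) ^ k) ^ ?d * ?U x) \<longlonglongrightarrow> 0 ^ ?d * ?U x"
      by (intro tendsto_intros LIMSEQ_realpow_zero) auto
    then have "\<forall>\<^sub>F k in sequentially. ((1 / 2) ^ k) ^ ?d * ?U x < 4 * K"
      using K(1) by (intro order_tendstoD(2)) (auto simp: power_0_left)
    then obtain k where "((1 / 2) ^ k) ^ ?d * ?U x < 4 * K"
      by (auto simp: eventually_sequentially)
    then have ex: "\<exists>k. x \<notin> E k" by (auto simp: E_def intro: exI[of _ k])
    \<comment> \<open>The first level not exceeded: each of the \<open>n\<close> earlier ones adds
      \<open>?U x\<close> to \<open>h x\<close>, and \<open>x \<notin> E n\<close> gives ln |u|^2 <=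
      ln (4 K) + n d ln 2.\<close>
    define n where "n = (LEAST k. x \<notin> E k)"
    have n: "x \<notin> E n" using ex unfolding n_def by (rule LeastI_ex)
    have less: "x \<in> E k" if "k < n" for k using not_less_Least that unfolding n_def by blast
    have "of_nat n * ennreal (?U x) = (\<Sum>k<n. ennreal (?U x) * indicator (E k) x)"
      using less by simp
    also have "\<dots> \<le> h x" unfolding h_def by (rule sum_le_suminf) auto
    finally have hn: "ennreal (n * ?U x) \<le> h x"
      using U by (simp add: ennreal_mult ennreal_of_nat_eq_real_of_nat)
    have "?U x \<le> 4 * K * 2 ^ (n * ?d)"
      using n by (simp add: E_def not_less power_mult[symmetric] power_one_over field_simps)
    then have "ln (?U x) \<le> ln (4 * K * 2 ^ (n * ?d))" using U K(1) by (subst ln_le_cancel_iff) auto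
    also have "\<dots> = ln (4 * K) + n * ?d * ln 2"
      using K(1) by (simp add: ln_mult ln_realpow)
    also have "\<dots> \<le> \<bar>ln (4 * K)\<bar> + n * ?d * ln 2" by simp
    finally have "?U x * ln (?U x) \<le> ?U x * (\<bar>ln (4 * K)\<bar> + n * ?d * ln 2)"
      using U by (intro mult_left_mono) auto
    then have "ennreal (?U x * ln (?U x)) \<le> ennreal (\<bar>ln (4 * K)\<bar> * ?U x + (?d * ln 2) * (n * ?U x))"
      by (intro ennreal_leI) (simp add: algebra_simps)
    also have "\<dots> = ennreal \<bar>ln (4 * K)\<bar> * ennreal (?U x) + ennreal (?d * ln 2) * ennreal (n * ?U x)"
      by (simp add: ennreal_plus ennreal_mult)
    also have "\<dots> \<le> ennreal \<bar>ln (4 * K)\<bar> * ennreal (?U x) + ennreal (?d * ln 2) * h x"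
      by (intro add_left_mono mult_left_mono hn) auto
    finally show ?thesis .
  qed simp
  then have "(\<integral>\<^sup>+x. ennreal (?U x * ln (?U x)) \<partial>lborel)
      \<le> (\<integral>\<^sup>+x. ennreal \<bar>ln (4 * K)\<bar> * ennreal (?U x) + ennreal (?d * ln 2) * h x \<partial>lborel)"
    by (intro nn_integral_mono)
  also have "\<dots> = ennreal \<bar>ln (4 * K)\<bar> * (\<integral>\<^sup>+x. ennreal (?U x) \<partial>lborel) + ennreal (?d * ln 2) * (\<integral>\<^sup>+x. h x \<partial>lborel)"
    by (simp add: nn_integral_add nn_integral_cmult)
  also have "\<dots> < \<infinity>"
    using h unfolding nnU by (simp add: ennreal_mult_less_top)
  finally show ?thesis .
qed

text \<open>
  Where \<open>|u|\<close> is small the weight \<open>|x|\<^sup>2\<close> controls the logarithm, by Young's inequality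
  \<open>- U ln U \<le> - U ln m - U + m\<close> with the Gaussian \<open>m\<close>.
\<close>

lemma neg_log_le:
  fixes U r :: real
  assumes "0 \<le> U"
  shows "- (U * ln U) \<le> U * r + exp (- r)"
proof (cases "U = 0")
  case False
  with assms have U: "U > 0" by simp
  \<comment> \<open>This is ln y <= y - 1 at y = exp(-r) / U.\<close>
  then have "ln (exp (- r) / U) \<le> exp (- r) / U - 1" by (intro ln_le_minus_one) simp
  then have "U * (- r - ln U) \<le> U * (exp (- r) / U - 1)"
    using U by (intro mult_left_mono) (simp_all add: ln_div)
  then show ?thesis using U by (simp add: algebra_simps)
qed simp

lemma log_integrable_borel:
  fixes u :: "real^'n \<Rightarrow> 'b::euclidean_space"
  assumes [measurable]: "u \<in> borel_measurable borel" and u: "u \<in> L2"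
    and xu: "integrable lborel (\<lambda>x. (norm x)\<^sup>2 * (norm (u x))\<^sup>2)"
    and W: "\<And>i t. 0 \<le> t \<Longrightarrow> increment u (t *\<^sub>R axis i 1) \<le> ennreal (t\<^sup>2) * W" "W < \<infinity>"
  shows "integrable lborel (\<lambda>x. (norm (u x))\<^sup>2 * ln ((norm (u x))\<^sup>2))"
proof (rule integrableI_bounded)
  let ?L = "\<lambda>x. (norm (u x))\<^sup>2 * ln ((norm (u x))\<^sup>2)"
  let ?M = "\<lambda>x. (norm x)\<^sup>2 * (norm (u x))\<^sup>2 + exp (- (norm x)\<^sup>2 / 2)"
  have M: "integrable lborel ?M"
    by (intro Bochner_Integration.integrable_add xu gaussian_integrable)
  have "ennreal (- ?L x) \<le> ennreal (?M x)" for x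
  proof (rule ennreal_leI)
    \<comment> \<open>The choice r = |x|^2 / 2 makes exp(-r) the Gaussian and U r half of the
      weighted density.\<close>
    have "- ?L x \<le> (norm (u x))\<^sup>2 * ((norm x)\<^sup>2 / 2) + exp (- ((norm x)\<^sup>2 / 2))"
      by (rule neg_log_le) simp
    also have "\<dots> \<le> ?M x" by (simp add: mult.commute)
    finally show "- ?L x \<le> ?M x" .
  qed
  then have "(\<integral>\<^sup>+x. ennreal (- ?L x) \<partial>lborel) \<le> (\<integral>\<^sup>+x. ennreal (?M x) \<partial>lborel)"
    by (intro nn_integral_mono)
  also have "\<dots> < \<infinity>" using M by (subst nn_integral_eq_integral[OF M]) (auto intro!: add_nonneg_nonneg)
  finally have neg: "(\<integral>\<^sup>+x. ennreal (- ?L x) \<partial>lborel) < \<infinity>" .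
  have "(\<integral>\<^sup>+x. ennreal (norm (?L x)) \<partial>lborel) \<le> (\<integral>\<^sup>+x. ennreal (?L x) + ennreal (- ?L x) \<partial>lborel)"
  proof (rule nn_integral_mono)
    fix x
    show "ennreal (norm (?L x)) \<le> ennreal (?L x) + ennreal (- ?L x)"
      by (cases "?L x \<ge> 0") (auto simp: ennreal_neg)
  qed
  also have "\<dots> = (\<integral>\<^sup>+x. ennreal (?L x) \<partial>lborel) + (\<integral>\<^sup>+x. ennreal (- ?L x) \<partial>lborel)"
    by (rule nn_integral_add) measurable
  also have "\<dots> < \<infinity>" using neg log_tail_integral_finite[OF assms(1,2) W] by simp
  finally show "(\<integral>\<^sup>+x. ennreal (norm (?L x)) \<partial>lborel) < \<infinity>" .
qed measurable

section \<open>From Borel representatives to elements of \<open>Sigma_space\<close>\<close>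

lemma lebesgue_measurable_complex_borel_version:
  fixes u :: "'a::euclidean_space \<Rightarrow> complex"
  assumes [measurable]: "u \<in> borel_measurable lebesgue"
  obtains u' where "u' \<in> borel_measurable borel" "AE x in lebesgue. u x = u' x"
proof -
  have re: "(\<lambda>x. Re (u x)) \<in> borel_measurable lebesgue" and im: "(\<lambda>x. Im (u x)) \<in> borel_measurable lebesgue"
    by measurable
  obtain f where f: "f \<in> borel_measurable lborel" "AE x in lborel. Re (u x) = f x"
    using completion_ex_borel_measurable_real[OF re] by blast
  obtain g where g: "g \<in> borel_measurable lborel" "AE x in lborel. Im (u x) = g x"
    using completion_ex_borel_measurable_real[OF im] by blast
  show ?thesis
  proof (rule that)
    show "(\<lambda>x. Complex (f x) (g x)) \<in> borel_measurable borel"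
      using f g by (simp add: borel_measurable_complex_iff)
    have "AE x in lborel. u x = Complex (f x) (g x)"
      using f(2) g(2) by eventually_elim (simp add: complex_eq_iff)
    then show "AE x in lebesgue. u x = Complex (f x) (g x)" by (rule AE_completion)
  qed
qed

text \<open>The estimates for translates rely on Fubini and are stated for Borel functions, whereas
  an element of \<open>L2\<close> is only Lebesgue measurable.\<close>

lemma borel_version_L2:
  fixes u :: "real^'n \<Rightarrow> complex"
  assumes "u \<in> L2"
  obtains u' where "u' \<in> borel_measurable borel" "u' \<in> L2" "AE x in lebesgue. u x = u' x"
proof -
  have u [measurable]: "u \<in> borel_measurable lebesgue" and i: "integrable lebesgue (\<lambda>x. (norm (u x))\<^sup>2)"
    using assms by (auto simp: L2_def)
  obtain u' where u': "u' \<in> borel_measurable borel" and ae: "AE x in lebesgue. u x = u' x"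
    using lebesgue_measurable_complex_borel_version[OF u] .
  have m [measurable]: "u' \<in> borel_measurable lebesgue" using u' by (simp add: measurable_completion)
  have "integrable lebesgue (\<lambda>x. (norm (u' x))\<^sup>2)"
    using i by (rule integrable_cong_AE_imp) (use ae in \<open>auto elim: eventually_mono\<close>)
  then show ?thesis using that u' ae m by (auto simp: L2_def)
qed

lemma test_integral_borel:
  fixes u u' :: "real^'n \<Rightarrow> complex"
  assumes "u \<in> borel_measurable lebesgue" "u' \<in> borel_measurable borel" "AE x in lebesgue. u x = u' x"
    "\<And>i. smooth (\<psi> i)"
  shows "(\<integral>x. tensor \<psi> x *\<^sub>R u x \<partial>lebesgue) = (\<integral>x. tensor \<psi> x *\<^sub>R u' x \<partial>lborel)"
proof -
  have [measurable]: "tensor \<psi> \<in> borel_measurable borel"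
    by (intro borel_measurable_continuous_onI continuous_on_tensor assms(4))
  then have [measurable]: "tensor \<psi> \<in> borel_measurable lebesgue" by (simp add: measurable_completion)
  note [measurable] = assms(1,2)
  have [measurable]: "u' \<in> borel_measurable lebesgue" using assms(2) by (simp add: measurable_completion)
  have "(\<integral>x. tensor \<psi> x *\<^sub>R u x \<partial>lebesgue) = (\<integral>x. tensor \<psi> x *\<^sub>R u' x \<partial>lebesgue)"
    by (intro integral_cong_AE) (use assms(3) in \<open>auto elim: eventually_mono\<close>)
  also have "\<dots> = (\<integral>x. tensor \<psi> x *\<^sub>R u' x \<partial>lborel)"
    by (rule integral_completion) measurable
  finally show ?thesis .
qed

text \<open>Borel versions of \<open>u\<close> and of the components of its weak gradient meet the
  hypotheses of \<open>log_integrable_borel\<close>, and integrability returns to \<open>u\<close>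
  along equality almost everywhere.\<close>

lemma log_integrable:
  fixes u :: "real^'n \<Rightarrow> complex"
  assumes "u \<in> Sigma_space"
  shows "integrable lebesgue (\<lambda>x. (cmod (u x))\<^sup>2 * ln ((cmod (u x))\<^sup>2))"
proof -
  have H1: "u \<in> H1" and xu: "(\<lambda>x. norm x *\<^sub>R u x) \<in> L2" using assms by (auto simp: Sigma_space_def)
  have u: "u \<in> L2" and um [measurable]: "u \<in> borel_measurable lebesgue" using H1 by (auto simp: H1_def L2_def)
  obtain u' where u' [measurable]: "u' \<in> borel_measurable borel" and u'2: "u' \<in> L2" and ae: "AE x in lebesgue. u x = u' x"
    using borel_version_L2[OF u] .
  have [measurable]: "u' \<in> borel_measurable lebesgue" using u' by (simp add: measurable_completion)
  define g where "g = weak_gradient u"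
  have g: "g \<in> L2" "has_weak_gradient u g" using weak_gradient_props[OF H1] by (simp_all add: g_def)
  have "\<forall>i. \<exists>v. v \<in> borel_measurable borel \<and> v \<in> L2 \<and> (AE x in lebesgue. g x $ i = v x)"
  proof
    fix i
    show "\<exists>v. v \<in> borel_measurable borel \<and> v \<in> L2 \<and> (AE x in lebesgue. g x $ i = v x)"
      by (rule borel_version_L2[OF L2_nth[OF g(1), of i]]) blast
  qed
  from choice[OF this] obtain v where v_all: "\<forall>i. v i \<in> borel_measurable borel \<and> v i \<in> L2
      \<and> (AE x in lebesgue. g x $ i = v i x)" by blast
  then have v [measurable]: "\<And>i. v i \<in> borel_measurable borel"
    and v2: "\<And>i. v i \<in> L2" and vae: "\<And>i. AE x in lebesgue. g x $ i = v i x" by blast+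
  \<comment> \<open>One constant for all axes: the sum of the component masses dominates each of
    them.\<close>
  define W where "W = (\<Sum>i\<in>UNIV. \<integral>\<^sup>+x. ennreal ((norm (v i x))\<^sup>2) \<partial>lborel)"
  have "(\<integral>\<^sup>+x. ennreal ((norm (v i x))\<^sup>2) \<partial>lborel) < \<infinity>" for i
    using v2[of i] by (simp add: L2_borel_iff integrable_iff_bounded)
  then have W: "W < \<infinity>" by (simp add: W_def)
  have inc: "increment u' (t *\<^sub>R axis i 1) \<le> ennreal (t\<^sup>2) * W" if "0 \<le> t" for i t
  proof -
    have "increment u' (t *\<^sub>R axis i 1) \<le> ennreal (t\<^sup>2) * (\<integral>\<^sup>+x. ennreal ((norm (v i x))\<^sup>2) \<partial>lborel)"
      unfolding increment_def
    proof (rule increment_L2_bound[OF u' v u'2 v2 that])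
      fix \<phi> :: "'n \<Rightarrow> real \<Rightarrow> real" assume \<phi>: "test_factors \<phi>"
      have "(\<integral>x. tensor (\<phi>(i := deriv (\<phi> i))) x *\<^sub>R u' x \<partial>lborel)
          = (\<integral>x. partial_deriv i (tensor \<phi>) x *\<^sub>R u x \<partial>lebesgue)"
        by (subst partial_deriv_tensor[OF test_factors_smooth[OF \<phi>]], rule test_integral_borel[symmetric, OF um u' ae])
           (auto intro: smooth_deriv test_factors_smooth[OF \<phi>])
      also have "\<dots> = - (\<integral>x. tensor \<phi> x *\<^sub>R (g x $ i) \<partial>lebesgue)"
        using g(2) test_function_tensor[OF \<phi>] unfolding has_weak_gradient_def by blast
      also have "(\<integral>x. tensor \<phi> x *\<^sub>R (g x $ i) \<partial>lebesgue) = (\<integral>x. tensor \<phi> x *\<^sub>R v i x \<partial>lborel)"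
        by (rule test_integral_borel[OF _ v vae test_factors_smooth[OF \<phi>]])
           (use L2_nth[OF g(1), of i] in \<open>simp add: L2_def\<close>)
      finally show "(\<integral>x. tensor (\<phi>(i := deriv (\<phi> i))) x *\<^sub>R u' x \<partial>lborel) = - (\<integral>x. tensor \<phi> x *\<^sub>R v i x \<partial>lborel)" .
    qed
    also have "\<dots> \<le> ennreal (t\<^sup>2) * W"
      unfolding W_def by (intro mult_left_mono member_le_sum) auto
    finally show ?thesis .
  qed
  have [measurable]: "(\<lambda>x :: real^'n. (norm x)\<^sup>2) \<in> borel_measurable lebesgue"
    by (intro measurable_completion) simp
  have "integrable lebesgue (\<lambda>x. (norm x)\<^sup>2 * (norm (u x))\<^sup>2)"
    using xu by (simp add: L2_def power_mult_distrib)
  then have "integrable lebesgue (\<lambda>x. (norm x)\<^sup>2 * (norm (u' x))\<^sup>2)"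
    by (rule integrable_cong_AE_imp) (use ae in \<open>auto elim: eventually_mono\<close>)
  then have "integrable lborel (\<lambda>x. (norm x)\<^sup>2 * (norm (u' x))\<^sup>2)"
    by (simp add: integrable_completion)
  from log_integrable_borel[OF u' u'2 this inc W]
  have "integrable lborel (\<lambda>x. (cmod (u' x))\<^sup>2 * ln ((cmod (u' x))\<^sup>2))" by simp
  then have "integrable lebesgue (\<lambda>x. (cmod (u' x))\<^sup>2 * ln ((cmod (u' x))\<^sup>2))"
    by (simp add: integrable_completion)
  then show ?thesis
    by (rule integrable_cong_AE_imp) (use ae in \<open>auto elim: eventually_mono\<close>)
qed

text \<open>The action is half of \<open>nehari\<close> minus \<open>lam\<close> times the mass.
  Splitting off the mass from the integral with ln - 1 is linearity of the integral and rests on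
  \<open>log_integrable\<close>.\<close>

lemma action_on_nehari:
  fixes u :: "real^'n \<Rightarrow> complex"
  assumes "u \<in> Sigma_space" "nehari lam om nu u = 0"
  shows "action lam om nu u = - lam * (L2_norm u)\<^sup>2"
proof -
  have "u \<in> L2" using assms(1) by (auto simp: Sigma_space_def H1_def)
  then have eq: "(\<integral>x. (cmod (u x))\<^sup>2 * (ln ((cmod (u x))\<^sup>2) - 1) \<partial>lebesgue)
      = (\<integral>x. (cmod (u x))\<^sup>2 * ln ((cmod (u x))\<^sup>2) \<partial>lebesgue) - (L2_norm u)\<^sup>2"
    using log_integrable[OF assms(1)]
    by (simp add: right_diff_distrib L2_norm_sq L2_def)
  then show ?thesis
    using assms(2) unfolding action_def energy_def nehari_def eq by (simp add: field_simps)
qed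

lemma L2_norm_pos:
  assumes "u \<in> L2" "ae_nonzero u"
  shows "0 < (L2_norm u)\<^sup>2"
proof -
  have i: "integrable lebesgue (\<lambda>x. (norm (u x))\<^sup>2)" using assms(1) by (simp add: L2_def)
  have "(\<integral>x. (norm (u x))\<^sup>2 \<partial>lebesgue) \<noteq> 0"
    using integral_nonneg_eq_0_iff_AE[OF i] assms(2) by (simp add: ae_nonzero_def)
  moreover have "0 \<le> (\<integral>x. (norm (u x))\<^sup>2 \<partial>lebesgue)" by simp
  ultimately show ?thesis by (simp only: L2_norm_sq)
qed

section \<open>Test functions as elements of the energy space\<close>

lemma continuous_compact_support_L2:
  fixes f :: "real^'n \<Rightarrow> 'b::euclidean_space"
  assumes "continuous_on UNIV f" "\<And>x. x \<notin> cbox a b \<Longrightarrow> f x = 0"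
  shows "f \<in> L2"
  unfolding L2_def using assms(1)
  by (auto intro!: continuous_compact_support_integrable(2)[of _ a b] continuous_intros measurable_completion
      borel_measurable_continuous_onI simp: assms(2))

lemma L2_scaleR: "f \<in> L2 \<Longrightarrow> (\<lambda>x. c *\<^sub>R f x) \<in> L2"
  unfolding L2_def by (auto simp: power_mult_distrib intro: borel_measurable_scaleR)

section \<open>Integration by parts for test functions\<close>

lemma partial_deriv_along_line:
  fixes h :: "real^'n \<Rightarrow> real"
  assumes "\<And>x. h differentiable (at x)"
  shows "((\<lambda>s. h (x + s *\<^sub>R axis i 1)) has_real_derivative partial_deriv i h (x + s *\<^sub>R axis i 1)) (at s)"
proof -
  let ?e = "axis i 1 :: real^'n"
  let ?D = "frechet_derivative h (at (x + s *\<^sub>R ?e))"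
  have D: "(h has_derivative ?D) (at (x + s *\<^sub>R ?e))"
    using assms frechet_derivative_works by blast
  have "((\<lambda>s. x + s *\<^sub>R ?e) has_derivative (\<lambda>r. r *\<^sub>R ?e)) (at s)"
    by (auto intro!: derivative_eq_intros)
  from has_derivative_compose[OF this D]
  have "((\<lambda>s. h (x + s *\<^sub>R ?e)) has_derivative (\<lambda>r. ?D (r *\<^sub>R ?e))) (at s)" .
  moreover have "?D (r *\<^sub>R ?e) = partial_deriv i h (x + s *\<^sub>R ?e) * r" for r
    using linear_scale[OF has_derivative_linear[OF D], of r ?e] by (simp add: partial_deriv_def)
  ultimately show ?thesis by (simp add: has_field_derivative_def)
qed

text \<open>The integrals of all difference quotients of \<open>h\<close> vanish by translation invariance.\<close>

lemma integral_partial_deriv_eq_0: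
  fixes h :: "real^'n \<Rightarrow> real"
  assumes diff: "\<And>x. h differentiable (at x)" and cont: "continuous_on UNIV (partial_deriv i h)"
    and supp: "\<And>x. x \<notin> cbox a b \<Longrightarrow> h x = 0"
  shows "(\<integral>x. partial_deriv i h x \<partial>lborel) = 0"
proof -
  let ?e = "axis i 1 :: real^'n" and ?a' = "a - axis i 1"
  define q where "q n x = (h (x + (1 / Suc n) *\<^sub>R ?e) - h x) * Suc n" for n x
  have h_cont: "continuous_on UNIV h"
    using diff by (intro continuous_at_imp_continuous_on ballI differentiable_imp_continuous_within)
  have [measurable]: "h \<in> borel_measurable borel" by (rule borel_measurable_continuous_onI[OF h_cont])
  have h_int: "integrable lborel h" by (rule continuous_compact_support_integrable(1)[OF h_cont supp])
  have q_0: "(\<integral>x. q n x \<partial>lborel) = 0" for n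
  proof -
    have "integrable lborel (\<lambda>x. h (x + (1 / Suc n) *\<^sub>R ?e))"
      using h_int integrable_lborel_translate[of h "(1 / Suc n) *\<^sub>R ?e"] by simp
    then show ?thesis
      unfolding q_def using h_int integral_lborel_translate[of h "(1 / Suc n) *\<^sub>R ?e"] by simp
  qed
  have q_lim: "(\<lambda>n. q n x) \<longlonglongrightarrow> partial_deriv i h x" for x
  proof -
    have "((\<lambda>s. (h (x + s *\<^sub>R ?e) - h x) / s) \<longlongrightarrow> partial_deriv i h x) (at 0)"
      using partial_deriv_along_line[OF diff, of x i 0] by (simp add: DERIV_def)
    moreover have "filterlim (\<lambda>n. 1 / real (Suc n)) (at 0) sequentially"
      using LIMSEQ_Suc[OF lim_1_over_n] by (rule filterlim_atI) simp
    ultimately have "(\<lambda>n. (h (x + (1 / Suc n) *\<^sub>R ?e) - h x) / (1 / Suc n)) \<longlonglongrightarrow> partial_deriv i h x"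
      by (rule filterlim_compose)
    then show ?thesis by (simp add: q_def)
  qed
  \<comment> \<open>A quotient looks ahead by at most \<open>?e\<close>, hence vanishes off the box
    whose lower corner is moved to \<open>?a'\<close>; that box carries the dominating
    function.\<close>
  have out: "x + s *\<^sub>R ?e \<notin> cbox a b" if "x \<notin> cbox ?a' b" "0 \<le> s" "s \<le> 1" for x s
  proof
    assume "x + s *\<^sub>R ?e \<in> cbox a b"
    then have "a $ j \<le> x $ j + s * ?e $ j \<and> x $ j + s * ?e $ j \<le> b $ j" for j
      by (simp add: mem_box_cart)
    moreover have "0 \<le> s * ?e $ j" "s * ?e $ j \<le> ?e $ j" for j
      using that(2,3) by (auto simp: axis_def)
    ultimately have "a $ j - ?e $ j \<le> x $ j \<and> x $ j \<le> b $ j" for j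
      by (smt (verit))
    with that(1) show False by (simp add: mem_box_cart)
  qed
  have q_out: "q n x = 0" if "x \<notin> cbox ?a' b" for n x
    using out[OF that, of 0] out[OF that, of "1 / Suc n"] supp by (simp add: q_def)
  have pd_out: "partial_deriv i h x = 0" if "x \<notin> cbox ?a' b" for x
    using q_lim[of x] q_out[OF that] by (simp add: LIMSEQ_const_iff)
  obtain C where C: "C > 0" "\<And>x. norm (partial_deriv i h x) \<le> C"
    using continuous_compact_support_bounded[OF cont pd_out] by blast
  \<comment> \<open>The mean value theorem along the axis bounds all quotients by the bound
    \<open>C\<close> of the partial derivative.\<close>
  have q_le: "\<bar>q n x\<bar> \<le> C" for n x
  proof -
    obtain z where "h (x + (1 / Suc n) *\<^sub>R ?e) - h (x + 0 *\<^sub>R ?e) = (1 / Suc n - 0) * partial_deriv i h (x + z *\<^sub>R ?e)"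
      using MVT2[of 0 "1 / Suc n" "\<lambda>s. h (x + s *\<^sub>R ?e)" "\<lambda>s. partial_deriv i h (x + s *\<^sub>R ?e)"]
        partial_deriv_along_line[OF diff] by auto
    then have "q n x = partial_deriv i h (x + z *\<^sub>R ?e)" by (simp add: q_def)
    then show ?thesis using C(2) by simp
  qed
  have "(\<lambda>n. \<integral>x. q n x \<partial>lborel) \<longlonglongrightarrow> (\<integral>x. partial_deriv i h x \<partial>lborel)"
  proof (rule integral_dominated_convergence)
    show "partial_deriv i h \<in> borel_measurable lborel"
      using borel_measurable_continuous_onI[OF cont] by simp
    show "q n \<in> borel_measurable lborel" for n unfolding q_def by measurable
    show "integrable lborel (\<lambda>x. indicator (cbox ?a' b) x * C)"
      by (intro integrable_mult_left integrable_real_indicator) (auto simp: emeasure_lborel_cbox_eq)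
    show "AE x in lborel. (\<lambda>n. q n x) \<longlonglongrightarrow> partial_deriv i h x" using q_lim by simp
    show "AE x in lborel. norm (q n x) \<le> indicator (cbox ?a' b) x * C" for n
      using q_le q_out by (auto simp: indicator_def)
  qed
  then show ?thesis using q_0 by (simp add: LIMSEQ_const_iff)
qed

lemma partial_deriv_mult:
  fixes f g :: "real^'n \<Rightarrow> real"
  assumes "f differentiable (at x)" "g differentiable (at x)"
  shows "partial_deriv i (\<lambda>x. f x * g x) x = f x * partial_deriv i g x + partial_deriv i f x * g x"
proof -
  have "((\<lambda>x. f x * g x) has_derivative
      (\<lambda>y. f x * frechet_derivative g (at x) y + frechet_derivative f (at x) y * g x)) (at x)"
    using assms frechet_derivative_works by (intro has_derivative_mult) blast+
  from frechet_derivative_at[OF this] show ?thesis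
    unfolding partial_deriv_def by metis
qed

lemma test_function_props:
  assumes "test_function f"
  shows "f differentiable (at x)" "continuous_on UNIV f" "continuous_on UNIV (partial_deriv i f)"
proof -
  have 0: "C_k 0 f" and 1: "C_k (Suc 0) f" using assms unfolding test_function_def by blast+
  show "f differentiable (at x)" "continuous_on UNIV f" "continuous_on UNIV (partial_deriv i f)"
    using 0 1 by auto
qed

lemma test_function_support:
  assumes "test_function f"
  obtains a b where "\<And>x. x \<notin> cbox a b \<Longrightarrow> f x = 0"
proof -
  have "bounded (closure {x. f x \<noteq> 0})" using assms by (simp add: test_function_def compact_imp_bounded)
  then obtain a where "closure {x. f x \<noteq> 0} \<subseteq> cbox (- a) a" using bounded_subset_cbox_symmetric by blast
  then show ?thesis using that closure_subset[of "{x. f x \<noteq> 0}"] by blast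
qed

text \<open>The product rule splits the derivative of \<open>f v\<close>, whose integral
  vanishes.\<close>

lemma integration_by_parts:
  fixes f v :: "real^'n \<Rightarrow> real"
  assumes f: "test_function f" and v: "test_function v"
  shows "(\<integral>x. partial_deriv i f x * v x \<partial>lborel) = - (\<integral>x. f x * partial_deriv i v x \<partial>lborel)"
proof -
  note f' = test_function_props[OF f] and v' = test_function_props[OF v]
  obtain a b where f0: "\<And>x. x \<notin> cbox a b \<Longrightarrow> f x = 0" using test_function_support[OF f] by blast
  obtain c d where v0: "\<And>x. x \<notin> cbox c d \<Longrightarrow> v x = 0" using test_function_support[OF v] by blast
  have pd: "partial_deriv i (\<lambda>x. f x * v x) = (\<lambda>x. f x * partial_deriv i v x + partial_deriv i f x * v x)"
    using partial_deriv_mult f'(1) v'(1) by blast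
  have "(\<integral>x. f x * partial_deriv i v x + partial_deriv i f x * v x \<partial>lborel) = 0"
    unfolding pd[symmetric]
  proof (rule integral_partial_deriv_eq_0)
    show "(\<lambda>x. f x * v x) differentiable (at x)" for x
      using f'(1) v'(1) by (rule differentiable_mult)
    show "continuous_on UNIV (partial_deriv i (\<lambda>x. f x * v x))"
      unfolding pd by (intro continuous_intros f' v')
    show "f x * v x = 0" if "x \<notin> cbox a b" for x using f0[OF that] by simp
  qed
  moreover have "integrable lborel (\<lambda>x. f x * partial_deriv i v x)"
    by (rule continuous_compact_support_integrable(1)[of _ a b]) (auto intro!: continuous_intros f' v' simp: f0)
  moreover have "integrable lborel (\<lambda>x. partial_deriv i f x * v x)"
    by (rule continuous_compact_support_integrable(1)[of _ c d]) (auto intro!: continuous_intros f' v' simp: v0)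
  ultimately show ?thesis by simp
qed

section \<open>Evaluating \<open>nehari\<close> through the classical gradient\<close>

definition gradient :: "(real^'n \<Rightarrow> real) \<Rightarrow> real^'n \<Rightarrow> complex^'n" where
  "gradient v x = (\<chi> i. complex_of_real (partial_deriv i v x))"

lemma has_weak_gradient_test_function:
  fixes v :: "real^'n \<Rightarrow> real"
  assumes v: "test_function v"
  shows "has_weak_gradient (\<lambda>x. complex_of_real (c * v x)) (\<lambda>x. c *\<^sub>R gradient v x)"
  unfolding has_weak_gradient_def
proof (intro allI impI)
  fix f :: "real^'n \<Rightarrow> real" and i :: 'n
  assume f: "test_function f"
  have [measurable]: "f \<in> borel_measurable borel" "v \<in> borel_measurable borel"
    "partial_deriv i f \<in> borel_measurable borel" "partial_deriv i v \<in> borel_measurable borel"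
    by (intro borel_measurable_continuous_onI test_function_props f v)+
  have "(\<integral>x. partial_deriv i f x *\<^sub>R complex_of_real (c * v x) \<partial>lebesgue)
      = (\<integral>x. complex_of_real (c * (partial_deriv i f x * v x)) \<partial>lborel)"
    by (subst integral_completion) (simp_all add: scaleR_conv_of_real mult_ac)
  also have "\<dots> = complex_of_real (c * (\<integral>x. partial_deriv i f x * v x \<partial>lborel))"
    by (subst integral_complex_of_real) simp
  also have "\<dots> = - complex_of_real (c * (\<integral>x. f x * partial_deriv i v x \<partial>lborel))"
    by (simp add: integration_by_parts[OF f v])
  also have "\<dots> = - (\<integral>x. complex_of_real (c * (f x * partial_deriv i v x)) \<partial>lborel)"
    by (subst integral_complex_of_real) simp
  also have "\<dots> = - (\<integral>x. f x *\<^sub>R ((c *\<^sub>R gradient v x) $ i) \<partial>lebesgue)"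
  proof -
    have "(c *\<^sub>R gradient v x) $ i = complex_of_real (c * partial_deriv i v x)" for x
      by (simp add: gradient_def scaleR_conv_of_real[of c "complex_of_real _"])
    then show ?thesis
      by (subst integral_completion) (simp_all add: scaleR_conv_of_real mult_ac)
  qed
  finally show "(\<integral>x. partial_deriv i f x *\<^sub>R complex_of_real (c * v x) \<partial>lebesgue)
      = - (\<integral>x. f x *\<^sub>R ((c *\<^sub>R gradient v x) $ i) \<partial>lebesgue)" .
qed

lemma partial_deriv_outside:
  fixes v :: "real^'n \<Rightarrow> real"
  assumes "\<And>x. x \<notin> cbox a b \<Longrightarrow> v x = 0" "x \<notin> cbox a b"
  shows "partial_deriv i v x = 0"
proof -
  have "((\<lambda>_. 0) has_derivative (\<lambda>_. 0)) (at x)" by simp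
  then have "(v has_derivative (\<lambda>_. 0)) (at x)"
    by (rule has_derivative_transform_within_open[where s = "- cbox a b"]) (use assms in auto)
  from frechet_derivative_at[OF this] show ?thesis unfolding partial_deriv_def by metis
qed

lemma gradient_L2:
  fixes v :: "real^'n \<Rightarrow> real"
  assumes v: "test_function v"
  shows "gradient v \<in> L2"
proof -
  obtain a b where ab: "\<And>x. x \<notin> cbox a b \<Longrightarrow> v x = 0" using test_function_support[OF v] by blast
  show ?thesis
  proof (rule continuous_compact_support_L2)
    show "continuous_on UNIV (gradient v)"
      unfolding gradient_def by (intro continuous_intros test_function_props v)
    show "gradient v x = 0" if "x \<notin> cbox a b" for x
      using partial_deriv_outside[of a b v, OF ab that] by (simp add: gradient_def vec_eq_iff)
  qed
qed

lemma test_function_Sigma: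
  fixes v :: "real^'n \<Rightarrow> real"
  assumes v: "test_function v"
  shows "(\<lambda>x. complex_of_real (c * v x)) \<in> L2" "(\<lambda>x. complex_of_real (c * v x)) \<in> Sigma_space"
proof -
  obtain a b where ab: "\<And>x. x \<notin> cbox a b \<Longrightarrow> v x = 0" using test_function_support[OF v] by blast
  note v' = test_function_props[OF v]
  show L2: "(\<lambda>x. complex_of_real (c * v x)) \<in> L2"
    by (rule continuous_compact_support_L2[of _ a b]) (auto intro!: continuous_intros v' simp: ab)
  have "(\<lambda>x. norm x *\<^sub>R complex_of_real (c * v x)) \<in> L2"
    by (rule continuous_compact_support_L2[of _ a b]) (auto intro!: continuous_intros v' simp: ab)
  moreover have "(\<lambda>x. c *\<^sub>R gradient v x) \<in> L2"
    by (rule L2_scaleR[OF gradient_L2[OF v]])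
  ultimately show "(\<lambda>x. complex_of_real (c * v x)) \<in> Sigma_space"
    unfolding Sigma_space_def H1_def using L2 has_weak_gradient_test_function[OF v] by blast
qed

text \<open>Scaling by \<open>c\<close> multiplies the quadratic terms by c^2 and adds ln c^2 times
  the mass inside the logarithmic one, so that the Nehari condition becomes an affine equation for
  ln c^2.\<close>

lemma nehari_test_function:
  fixes v :: "real^'n \<Rightarrow> real"
  assumes v: "test_function v" and c: "0 < c"
  shows "nehari lam om nu (\<lambda>x. complex_of_real (c * v x)) =
    c\<^sup>2 * ((\<integral>x. (norm (gradient v x))\<^sup>2 \<partial>lborel) - om\<^sup>2 * (\<integral>x. (norm x)\<^sup>2 * (v x)\<^sup>2 \<partial>lborel)
      + 2 * lam * ((\<integral>x. (v x)\<^sup>2 * ln ((v x)\<^sup>2) \<partial>lborel) + ln (c\<^sup>2) * (\<integral>x. (v x)\<^sup>2 \<partial>lborel))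
      + 2 * nu * (\<integral>x. (v x)\<^sup>2 \<partial>lborel))" (is ?n)
    and "(L2_norm (\<lambda>x. complex_of_real (c * v x)))\<^sup>2 = c\<^sup>2 * (\<integral>x. (v x)\<^sup>2 \<partial>lborel)" (is ?l)
proof -
  let ?u = "\<lambda>x. complex_of_real (c * v x)"
  obtain a b where ab: "\<And>x. x \<notin> cbox a b \<Longrightarrow> v x = 0" using test_function_support[OF v] by blast
  note v' = test_function_props[OF v]
  have [measurable]: "v \<in> borel_measurable borel"
    by (intro borel_measurable_continuous_onI v')
  have "continuous_on UNIV (gradient v)"
    unfolding gradient_def by (intro continuous_intros v')
  then have [measurable]: "gradient v \<in> borel_measurable borel"
    by (rule borel_measurable_continuous_onI)
  have gL2: "(\<lambda>x. c *\<^sub>R gradient v x) \<in> L2"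
    by (rule L2_scaleR[OF gradient_L2[OF v]])
  have G: "(L2_norm (weak_gradient ?u))\<^sup>2 = c\<^sup>2 * (\<integral>x. (norm (gradient v x))\<^sup>2 \<partial>lborel)"
    unfolding L2_norm_weak_gradient[OF test_function_Sigma(1)[OF v] gL2 has_weak_gradient_test_function[OF v]] L2_norm_sq
    by (simp add: power_mult_distrib integral_completion)
  have X: "(L2_norm (\<lambda>x. norm x *\<^sub>R ?u x))\<^sup>2 = c\<^sup>2 * (\<integral>x. (norm x)\<^sup>2 * (v x)\<^sup>2 \<partial>lborel)"
    unfolding L2_norm_sq
    by (subst integral_completion) (simp_all add: norm_mult power_mult_distrib mult.left_commute)
  show V: ?l
    unfolding L2_norm_sq by (subst integral_completion) (simp_all add: norm_mult power_mult_distrib)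
  have i1: "integrable lborel (\<lambda>x. (v x)\<^sup>2 * ln ((v x)\<^sup>2))"
    using log_integrable[OF test_function_Sigma(2)[OF v, of 1]] by (simp add: integrable_completion)
  have i2: "integrable lborel (\<lambda>x. (v x)\<^sup>2)"
    by (rule continuous_compact_support_integrable(1)[of _ a b]) (auto intro!: continuous_intros v' simp: ab)
  have "(\<integral>x. (cmod (?u x))\<^sup>2 * ln ((cmod (?u x))\<^sup>2) \<partial>lebesgue)
      = (\<integral>x. c\<^sup>2 * ((v x)\<^sup>2 * ln ((v x)\<^sup>2) + ln (c\<^sup>2) * (v x)\<^sup>2) \<partial>lborel)"
  proof (subst integral_completion)
    show "(\<integral>x. (cmod (?u x))\<^sup>2 * ln ((cmod (?u x))\<^sup>2) \<partial>lborel)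
      = (\<integral>x. c\<^sup>2 * ((v x)\<^sup>2 * ln ((v x)\<^sup>2) + ln (c\<^sup>2) * (v x)\<^sup>2) \<partial>lborel)"
    proof (rule Bochner_Integration.integral_cong[OF refl])
      fix x
      have "(cmod (?u x))\<^sup>2 = c\<^sup>2 * (v x)\<^sup>2" by (simp add: norm_mult power_mult_distrib)
      \<comment> \<open>Where \<open>v x = 0\<close> both sides vanish whatever \<open>ln 0\<close>
        is; elsewhere the logarithm of the product splits.\<close>
      then show "(cmod (?u x))\<^sup>2 * ln ((cmod (?u x))\<^sup>2) = c\<^sup>2 * ((v x)\<^sup>2 * ln ((v x)\<^sup>2) + ln (c\<^sup>2) * (v x)\<^sup>2)"
        using c by (cases "v x = 0") (simp_all add: ln_mult_pos[of "c\<^sup>2" "(v x)\<^sup>2"] algebra_simps)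
    qed
  qed measurable
  also have "\<dots> = c\<^sup>2 * ((\<integral>x. (v x)\<^sup>2 * ln ((v x)\<^sup>2) \<partial>lborel) + ln (c\<^sup>2) * (\<integral>x. (v x)\<^sup>2 \<partial>lborel))"
    using i1 i2 by simp
  finally have J: "(\<integral>x. (cmod (?u x))\<^sup>2 * ln ((cmod (?u x))\<^sup>2) \<partial>lebesgue) = \<dots>" .
  show ?n
    unfolding nehari_def G X J V by (simp add: algebra_simps)
qed

section \<open>Small functions on the Nehari manifold\<close>

text \<open>The unit cube is pushed along the diagonal instead of one axis: all factors stay equal,
  and any single coordinate bounds the norm from below.\<close>

definition wave :: "real \<Rightarrow> real^'n \<Rightarrow> real" where
  "wave R = tensor (\<lambda>_. bump R (R + 1) 1)"

lemma test_function_wave: "test_function (wave R :: real^'n \<Rightarrow> real)"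
  unfolding wave_def by (intro test_function_tensor test_factors_bump)

lemma bump_translate: "bump R (R + 1) n t = bump 0 1 n (t - R)"
  by (simp add: bump_def algebra_simps)

lemma deriv_bump_translate: "deriv (bump R (R + 1) n) t = deriv (bump 0 1 n) (t - R)"
proof (rule DERIV_imp_deriv)
  have "((\<lambda>t. bump 0 1 n (t - R)) has_real_derivative deriv (bump 0 1 n) (t - R) * 1) (at t)"
    by (rule DERIV_chain2[OF smooth_DERIV[OF smooth_bump]]) (auto intro!: derivative_eq_intros)
  then show "(bump R (R + 1) n has_real_derivative deriv (bump 0 1 n) (t - R)) (at t)"
    by (simp flip: bump_translate)
qed

lemma wave_translate: "wave R x = wave 0 (x + (- R) *\<^sub>R 1)"
  by (simp add: wave_def tensor_def bump_translate[of R])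

lemma gradient_wave_translate: "gradient (wave R) x = gradient (wave 0) (x + (- R) *\<^sub>R 1)"
  unfolding gradient_def wave_def
  by (subst (1 2) partial_deriv_tensor)
     (auto simp: smooth_bump vec_eq_iff tensor_def bump_translate[of R] deriv_bump_translate[of R] intro!: prod.cong)

lemma wave_continuous: "continuous_on UNIV (wave R)"
  by (intro test_function_props test_function_wave)

lemma borel_measurable_wave[measurable]: "wave R \<in> borel_measurable borel"
  by (intro borel_measurable_continuous_onI wave_continuous)

lemma borel_measurable_gradient_wave[measurable]: "gradient (wave R) \<in> borel_measurable borel"
proof (rule borel_measurable_continuous_onI)
  show "continuous_on UNIV (gradient (wave R))"
    unfolding gradient_def by (intro continuous_intros test_function_props test_function_wave)
qed

lemma wave_support: "x \<notin> box 0 1 \<Longrightarrow> wave 0 x = 0"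
  by (force simp: wave_def tensor_def mem_box_cart intro: bump_eq_0)

lemma wave_pos: "x \<in> box 0 1 \<Longrightarrow> 0 < wave 0 x"
  by (auto simp: wave_def tensor_def mem_box_cart intro!: prod_pos bump_pos)

lemma wave_not_AE_0: "\<not> (AE x in lebesgue. wave 0 (x :: real^'n) = 0)"
proof
  assume "AE x in lebesgue. wave 0 (x :: real^'n) = 0"
  then obtain N where N: "N \<in> null_sets lebesgue" "{x :: real^'n. wave 0 x \<noteq> 0} \<subseteq> N"
    by (auto simp: eventually_ae_filter)
  have "box 0 1 \<subseteq> N" using N(2) wave_pos by fastforce
  then have "negligible (box 0 (1 :: real^'n))"
    using N(1) negligible_subset by (auto simp: negligible_iff_null_sets)
  then have "box 0 (1 :: real^'n) = {}" using open_not_negligible open_box by blast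
  then show False by (auto simp: interval_eq_empty_cart)
qed

lemma wave_sq_integrable: "integrable lborel (\<lambda>x :: real^'n. (wave 0 x)\<^sup>2)"
  by (rule continuous_compact_support_integrable(1)[of _ 0 1])
     (use wave_support box_subset_cbox[of 0 1] in \<open>auto intro!: continuous_intros wave_continuous\<close>)

lemma wave_mass_pos: "0 < (\<integral>x. (wave 0 (x :: real^'n))\<^sup>2 \<partial>lborel)"
proof -
  have "(\<integral>x. (wave 0 (x :: real^'n))\<^sup>2 \<partial>lborel) \<noteq> 0"
    using integral_nonneg_eq_0_iff_AE[OF wave_sq_integrable[where 'n='n]] wave_not_AE_0[where 'n='n]
    by (simp add: AE_completion_iff)
  moreover have "0 \<le> (\<integral>x. (wave 0 (x :: real^'n))\<^sup>2 \<partial>lborel)" by simp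
  ultimately show ?thesis by linarith
qed

text \<open>After translation to the unit cube the weight is |x + R (1, ..., 1)|^2, and each
  coordinate of that vector is at least R on the support.\<close>

lemma wave_moment_ge:
  assumes R: "0 \<le> R"
  shows "R\<^sup>2 * (\<integral>x. (wave 0 (x :: real^'n))\<^sup>2 \<partial>lborel) \<le> (\<integral>x. (norm x)\<^sup>2 * (wave R (x :: real^'n))\<^sup>2 \<partial>lborel)"
proof -
  have "(\<integral>x. (norm x)\<^sup>2 * (wave R (x :: real^'n))\<^sup>2 \<partial>lborel) = (\<integral>x. (norm (x + R *\<^sub>R 1))\<^sup>2 * (wave 0 (x :: real^'n))\<^sup>2 \<partial>lborel)"
    using integral_lborel_translate[of "\<lambda>x. (norm x)\<^sup>2 * (wave R (x :: real^'n))\<^sup>2" "R *\<^sub>R 1"]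
    by (simp add: wave_translate[of R])
  moreover have "(\<integral>x. R\<^sup>2 * (wave 0 (x :: real^'n))\<^sup>2 \<partial>lborel) \<le> (\<integral>x. (norm (x + R *\<^sub>R 1))\<^sup>2 * (wave 0 (x :: real^'n))\<^sup>2 \<partial>lborel)"
  proof (rule integral_mono)
    show "integrable lborel (\<lambda>x. R\<^sup>2 * (wave 0 (x :: real^'n))\<^sup>2)" by (intro integrable_mult_right wave_sq_integrable)
    show "integrable lborel (\<lambda>x. (norm (x + R *\<^sub>R 1))\<^sup>2 * (wave 0 (x :: real^'n))\<^sup>2)"
      by (rule continuous_compact_support_integrable(1)[of _ 0 1])
         (use wave_support box_subset_cbox[of 0 1] in \<open>auto intro!: continuous_intros wave_continuous\<close>)
    fix x :: "real^'n"
    show "R\<^sup>2 * (wave 0 x)\<^sup>2 \<le> (norm (x + R *\<^sub>R 1))\<^sup>2 * (wave 0 x)\<^sup>2"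
    proof (cases "x \<in> box 0 1")
      case True
      \<comment> \<open>Any coordinate serves; \<open>undefined\<close> names one.\<close>
      then have "R \<le> (x + R *\<^sub>R 1) $ undefined" by (simp add: mem_box_cart less_imp_le)
      also have "\<dots> \<le> norm (x + R *\<^sub>R 1)" using component_le_norm_cart abs_ge_self order_trans by blast
      finally show ?thesis using R by (intro mult_right_mono power_mono) auto
    qed (simp add: wave_support)
  qed
  ultimately show ?thesis by simp
qed

lemma nehari_small_mass:
  fixes lam om nu \<epsilon> :: real
  assumes lam: "lam < 0" and om: "0 < om" and \<epsilon>: "0 < \<epsilon>"
  obtains u :: "real^'n \<Rightarrow> complex" where "u \<in> Sigma_space" "ae_nonzero u" "nehari lam om nu u = 0" "(L2_norm u)\<^sup>2 < \<epsilon>"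
proof -
  define V where "V = (\<integral>x. (wave 0 (x :: real^'n))\<^sup>2 \<partial>lborel)"
  define J where "J = (\<integral>x. (wave 0 (x :: real^'n))\<^sup>2 * ln ((wave 0 x)\<^sup>2) \<partial>lborel)"
  define G where "G = (\<integral>x. (norm (gradient (wave 0) (x :: real^'n)))\<^sup>2 \<partial>lborel)"
  define M where "M R = (\<integral>x. (norm x)\<^sup>2 * (wave R (x :: real^'n))\<^sup>2 \<partial>lborel)" for R
  have V: "0 < V" unfolding V_def by (rule wave_mass_pos)
  have V_eq: "(\<integral>x. (wave R (x :: real^'n))\<^sup>2 \<partial>lborel) = V" for R
    using integral_lborel_translate[of "\<lambda>x. (wave 0 (x :: real^'n))\<^sup>2" "(- R) *\<^sub>R 1"]
    by (simp only: wave_translate[of R] V_def) simp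
  have J_eq: "(\<integral>x. (wave R (x :: real^'n))\<^sup>2 * ln ((wave R x)\<^sup>2) \<partial>lborel) = J" for R
    using integral_lborel_translate[of "\<lambda>x. (wave 0 (x :: real^'n))\<^sup>2 * ln ((wave 0 x)\<^sup>2)" "(- R) *\<^sub>R 1"]
    by (simp only: wave_translate[of R] J_def) simp
  have G_eq: "(\<integral>x. (norm (gradient (wave R) (x :: real^'n)))\<^sup>2 \<partial>lborel) = G" for R
    using integral_lborel_translate[of "\<lambda>x. (norm (gradient (wave 0) (x :: real^'n)))\<^sup>2" "(- R) *\<^sub>R 1"]
    by (simp only: gradient_wave_translate[of R] G_def) simp
  \<comment> \<open>The value of ln c^2 at which the bracket in \<open>nehari_test_function\<close>
    vanishes; the mass of the resulting function is exp(q R) V.\<close>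
  define q where "q R = (G - om\<^sup>2 * M R + 2 * lam * J + 2 * nu * V) / (- 2 * lam * V)" for R
  have "\<exists>R\<ge>0. exp (q R) * V < \<epsilon>"
  proof -
    \<comment> \<open>With the moment replaced by its lower bound R^2 V, the inequality
      \<open>q R < ln (\<epsilon> / V)\<close> follows from R^2 > B; the numerator collects the
      terms independent of R.\<close>
    define B where "B = (G + 2 * lam * J + 2 * nu * V - ln (\<epsilon> / V) * (- 2 * lam * V)) / (om\<^sup>2 * V)"
    define R where "R = \<bar>B\<bar> + 1"
    have R: "0 \<le> R" by (simp add: R_def)
    have "B < R" by (simp add: R_def)
    \<comment> \<open>The choice of \<open>R\<close> makes it at least 1, so its square exceeds
      \<open>B\<close> as well.\<close>
    also have "R \<le> R\<^sup>2" using power_increasing[of 1 2 R] by (simp add: R_def)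
    finally have "B * (om\<^sup>2 * V) < R\<^sup>2 * (om\<^sup>2 * V)" using V om by (intro mult_strict_right_mono) auto
    then have "G + 2 * lam * J + 2 * nu * V - ln (\<epsilon> / V) * (- 2 * lam * V) < om\<^sup>2 * (R\<^sup>2 * V)"
      using V om by (simp add: B_def mult_ac)
    also have "\<dots> \<le> om\<^sup>2 * M R"
      using wave_moment_ge[OF R] unfolding M_def V_def by (intro mult_left_mono) auto
    finally have "G - om\<^sup>2 * M R + 2 * lam * J + 2 * nu * V < ln (\<epsilon> / V) * (- 2 * lam * V)" by simp
    then have "q R < ln (\<epsilon> / V)"
      using V lam unfolding q_def by (subst pos_divide_less_eq) (auto simp: mult_neg_pos)
    then have "exp (q R) < \<epsilon> / V" using V \<epsilon> by (metis divide_pos_pos exp_less_mono exp_ln)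
    then show ?thesis using V R by (auto simp: pos_less_divide_eq)
  qed
  then obtain R where R: "exp (q R) * V < \<epsilon>" by blast
  define c where "c = exp (q R / 2)"
  have c: "0 < c" and c2: "c\<^sup>2 = exp (q R)" by (simp_all add: c_def flip: exp_double)
  let ?u = "\<lambda>x :: real^'n. complex_of_real (c * wave R x)"
  have mass: "(L2_norm ?u)\<^sup>2 = exp (q R) * V"
    using nehari_test_function(2)[OF test_function_wave[of R, where 'n='n] c] by (simp add: V_eq c2)
  show ?thesis
  proof (rule that)
    show "?u \<in> Sigma_space" by (rule test_function_Sigma(2)[OF test_function_wave])
    show "ae_nonzero ?u"
    proof -
      have "?u \<in> L2" by (rule test_function_Sigma(1)[OF test_function_wave])
      then have [measurable]: "?u \<in> borel_measurable lebesgue" by (simp add: L2_def)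
      have "(L2_norm ?u)\<^sup>2 \<noteq> 0" using mass V by simp
      moreover have "(L2_norm ?u)\<^sup>2 = 0" if "AE x in lebesgue. ?u x = 0"
        unfolding L2_norm_sq
        by (rule integral_eq_zero_AE) (use that in \<open>auto elim: eventually_mono\<close>)
      ultimately show ?thesis unfolding ae_nonzero_def by blast
    qed
    have "2 * lam * V * q R = - (G - om\<^sup>2 * M R + 2 * lam * J + 2 * nu * V)"
      using V lam by (simp add: q_def)
    then show "nehari lam om nu ?u = 0"
      unfolding nehari_test_function(1)[OF test_function_wave c] V_eq J_eq G_eq M_def[symmetric] c2
      by (simp add: algebra_simps)
    show "(L2_norm ?u)\<^sup>2 < \<epsilon>" using mass R by simp
  qed
qed

theorem proposition4p1:
  fixes lam om nu :: real
  assumes "lam < 0" and "0 < om"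
  shows "ground_level TYPE('n::finite) lam om nu = 0
    \<and> (ground_states lam om nu :: (real^'n \<Rightarrow> complex) set) = {}"
proof -
  let ?A = "{u :: real^'n \<Rightarrow> complex. u \<in> Sigma_space \<and> ae_nonzero u \<and> nehari lam om nu u = 0}"
  have pos: "0 < action lam om nu u" if "u \<in> ?A" for u :: "real^'n \<Rightarrow> complex"
  proof -
    have "u \<in> L2" using that by (auto simp: Sigma_space_def H1_def)
    then have "0 < (L2_norm u)\<^sup>2" using L2_norm_pos that by blast
    then show ?thesis
      using action_on_nehari[of u lam om nu] that assms(1) by (simp add: mult_neg_pos)
  qed
  have level: "ground_level TYPE('n) lam om nu = 0"
  proof (rule antisym)
    show "0 \<le> ground_level TYPE('n) lam om nu"
      unfolding ground_level_def using pos by (intro INF_greatest) (simp add: less_imp_le)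
    show "ground_level TYPE('n) lam om nu \<le> 0"
    proof (rule ereal_le_epsilon2)
      fix e :: real assume "0 < e"
      \<comment> \<open>Since the action is -lam times the mass, mass below e / (- lam) keeps it
        below \<open>e\<close>.\<close>
      then have "0 < e / (- lam)" using assms(1) by (intro divide_pos_pos) auto
      then obtain u :: "real^'n \<Rightarrow> complex" where u: "u \<in> Sigma_space" "ae_nonzero u" "nehari lam om nu u = 0"
        "(L2_norm u)\<^sup>2 < e / (- lam)"
        using nehari_small_mass[OF assms] by blast
      have "(L2_norm u)\<^sup>2 * (- lam) < e"
        using u(4) assms(1) by (subst (asm) pos_less_divide_eq) auto
      then have "action lam om nu u \<le> e"
        using action_on_nehari[OF u(1,3)] by (simp add: mult.commute)
      moreover have "ground_level TYPE('n) lam om nu \<le> ereal (action lam om nu u)"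
        unfolding ground_level_def using u by (intro INF_lower) simp
      ultimately show "ground_level TYPE('n) lam om nu \<le> 0 + ereal e"
        by (simp add: order_trans)
    qed
  qed
  \<comment> \<open>The value 0 is not attained, because the action is strictly positive on the
    whole manifold.\<close>
  moreover have "ground_states lam om nu = ({} :: (real^'n \<Rightarrow> complex) set)"
    unfolding ground_states_def level using pos by (fastforce simp: zero_ereal_def)
  ultimately show ?thesis by simp
qed

end
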